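(* Let $\phi$ (with potential $\Phi$), $F$ and $j$ satisfy the standing assumptions stated in the context, and let $d_N^1:=\{(x,x):x\in\mathbb{R}^N\}$. If either $$\limsup_{|x|\to\infty}F(t,x)<\min_{\overline{B}_a}\Phi-\Phi(0)\quad\text{uniformly with }t\in[0,T],$$ or $j|_{d_N^1}\equiv0$, $j|_{D(j)}$ is bounded and $$\lim_{|x|\to\infty}F(t,x)=+\infty\quad\text{uniformly with }t\in[0,T],$$ then the boundary value problem $$-[\phi(u')]'=\nabla_uF(t,u)\ \text{ in }[0,T],\qquad \big(\phi(u')(0),-\phi(u')(T)\big)\in\partial j(u(0),u(T))$$ has at least one solution.
   Context: $N\ge 1$ is an integer, $T>0$, $0<a<\infty$; $|\cdot|$ is the Euclidean norm on $\mathbb{R}^N$; $B_a$ is the open ball of radius $a$ centered at $0$. Standing assumptions. (1) $\phi$ is a homeomorphism from $B_a$ onto $\mathbb{R}^N$ with $\phi(0)=0$ and $\phi=\nabla\Phi$ on $B_a$, where $\Phi:\overline{B}_a\to(-\infty,0]$ is of class $C^1$ on $B_a$, and continuous and strictly convex on $\overline{B}_a$. (2) $F=F(t,u):[0,T]\times\mathbb{R}^N\to\mathbb{R}$ is continuous, $\nabla_uF$ exists and is continuous on $[0,T]\times\mathbb{R}^N$, and $F(\cdot,0)=0$. (3) $j:\mathbb{R}^N\times\mathbb{R}^N\to(-\infty,+\infty]$ is proper, convex, lower semicontinuous, $j(0)=0$ and $0\in\partial j(0)$, where $\partial j$ is the subdifferential of convex analysis. $D(j)=\{z:j(z)<+\infty\}$.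 The first (limsup) condition, uniformly in $t$, means: there exist $\varepsilon>0$ and $\rho>0$ such that $F(t,x)<\min_{\overline{B}_a}\Phi-\Phi(0)-\varepsilon$ for all $t\in[0,T]$ and all $|x|>\rho$. A solution of the boundary value problem is a function $u\in C^1([0,T];\mathbb{R}^N)$ with $|u'(t)|<a$ for all $t\in[0,T]$, $\phi(u')\in C^1([0,T];\mathbb{R}^N)$, $(u(0),u(T))\in D(\partial j)=\{z:\partial j(z)\ne\emptyset\}$, satisfying the system and the boundary condition; $\phi(u')(t)=\phi(u'(t))$. *)

theory Defs
  imports "HOL-Analysis.Analysis"
begin

section \<open>Extended-real-valued convex functions\<close>

definition eff_dom :: "('a \<Rightarrow> ereal) \<Rightarrow> 'a set" where
  "eff_dom j = {z. j z < \<infinity>}"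

definition proper_fun :: "('a \<Rightarrow> ereal) \<Rightarrow> bool" where
  "proper_fun j \<longleftrightarrow> (\<forall>z. j z \<noteq> -\<infinity>) \<and> eff_dom j \<noteq> {}"

text \<open>Meant for functions that omit the value \<open>-\<infinity>\<close>, for which no sum \<open>\<infinity> + (-\<infinity>)\<close> occurs.\<close>

definition econvex :: "('a::real_vector \<Rightarrow> ereal) \<Rightarrow> bool" where
  "econvex j \<longleftrightarrow>
     (\<forall>x y t. 0 < t \<and> t < 1 \<longrightarrow>
        j ((1 - t) *\<^sub>R x + t *\<^sub>R y) \<le> ereal (1 - t) * j x + ereal t * j y)"

definition lower_semicont :: "('a::topological_space \<Rightarrow> ereal) \<Rightarrow> bool" where
  "lower_semicont j \<longleftrightarrow> (\<forall>z. j z \<le> Liminf (at z) j)"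

text \<open>The subdifferential of a proper \<open>j\<close> is empty at every \<open>z\<close> with \<open>j z = \<infinity>\<close>, since the
  inequality then fails at any point of the effective domain.\<close>

definition subdifferential :: "('a::real_inner \<Rightarrow> ereal) \<Rightarrow> 'a \<Rightarrow> 'a set" where
  "subdifferential j z = {w. \<forall>y. j y \<ge> j z + ereal (w \<bullet> (y - z))}"

definition subdiff_dom :: "('a::real_inner \<Rightarrow> ereal) \<Rightarrow> 'a set" where
  "subdiff_dom j = {z. subdifferential j z \<noteq> {}}"

section \<open>Real-valued functions\<close>

definition strictly_convex_on :: "'a::real_vector set \<Rightarrow> ('a \<Rightarrow> real) \<Rightarrow> bool" where
  "strictly_convex_on S f \<longleftrightarrow>
     convex S \<and>
     (\<forall>x\<in>S. \<forall>y\<in>S. \<forall>t. x \<noteq> y \<and> 0 < t \<and> t < 1 \<longrightarrow>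
        f ((1 - t) *\<^sub>R x + t *\<^sub>R y) < (1 - t) * f x + t * f y)"

text \<open>The infimum of a continuous function over a closed ball is a minimum.\<close>

lemma Inf_cball_is_min:
  fixes \<Phi> :: "'a::euclidean_space \<Rightarrow> real"
  assumes "0 \<le> a" and "continuous_on (cball 0 a) \<Phi>"
  shows "\<exists>x\<in>cball 0 a. \<Phi> x = (INF y\<in>cball 0 a. \<Phi> y) \<and> (\<forall>y\<in>cball 0 a. \<Phi> x \<le> \<Phi> y)"
proof -
  obtain x where x: "x \<in> cball 0 a" "\<forall>y\<in>cball 0 a. \<Phi> x \<le> \<Phi> y"
    using continuous_attains_inf[OF compact_cball _ assms(2)] assms(1)
    by (metis cball_eq_empty not_le)
  then have "(INF y\<in>cball 0 a. \<Phi> y) = \<Phi> x"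
    by (intro cInf_eq_minimum) auto
  with x show ?thesis by auto
qed

section \<open>The boundary value problem\<close>

text \<open>\<open>f\<close> is of class \<open>C\<^sup>1\<close> on \<open>S\<close> with derivative \<open>f'\<close>; derivatives at endpoints of an interval
  \<open>S\<close> are one-sided.\<close>

definition C1_with_deriv_on ::
    "real set \<Rightarrow> (real \<Rightarrow> 'a::real_normed_vector) \<Rightarrow> (real \<Rightarrow> 'a) \<Rightarrow> bool" where
  "C1_with_deriv_on S f f' \<longleftrightarrow>
     (\<forall>t\<in>S. (f has_vector_derivative f' t) (at t within S)) \<and> continuous_on S f'"

text \<open>\<open>G t x\<close> stands for the gradient of \<open>F t\<close> at \<open>x\<close>. Here \<open>v\<close> is \<open>u'\<close> and \<open>w\<close> is \<open>[\<phi>(u')]'\<close>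
  on \<open>[0,T]\<close>.\<close>

definition is_solution ::
    "real \<Rightarrow> real \<Rightarrow> ('a::euclidean_space \<Rightarrow> 'a) \<Rightarrow> (real \<Rightarrow> 'a \<Rightarrow> 'a) \<Rightarrow> ('a \<times> 'a \<Rightarrow> ereal)
       \<Rightarrow> (real \<Rightarrow> 'a) \<Rightarrow> bool" where
  "is_solution T a \<phi> G j u \<longleftrightarrow>
     (\<exists>v w.
        C1_with_deriv_on {0..T} u v \<and>
        (\<forall>t\<in>{0..T}. norm (v t) < a) \<and>
        C1_with_deriv_on {0..T} (\<lambda>t. \<phi> (v t)) w \<and>
        (u 0, u T) \<in> subdiff_dom j \<and>
        (\<forall>t\<in>{0..T}. - w t = G t (u t)) \<and>
        (\<phi> (v 0), - \<phi> (v T)) \<in> subdifferential j (u 0, u T))"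

end

theory Submission
  imports Defs "HOL-Complex_Analysis.Great_Picard"
begin

text \<open>Suppose that there is no solution. The action functional, a convex term plus a \<open>C\<^sup>1\<close> term, is then
  decreased by a conditional gradient step \<open>u \<mapsto> u + s (U u - u)\<close>, where \<open>U u\<close> minimises the functional
  with the \<open>C\<^sup>1\<close> term linearised at \<open>u\<close> and the penalty
  \<open>(|z(0) - u(0)|\<^sup>2 + |z(T) - u(T)|\<^sup>2) / 2\<close> added. Such a \<open>U u\<close> is found by solving an equation
  \<open>A(p) = 0\<close> in \<open>\<real>\<^sup>N\<close> for a strictly monotone coercive map \<open>A\<close>, and depends continuously on
  \<open>u\<close>. Since the velocities are bounded, compactness makes the decrease uniform over curves with bounded
  \<open>u(0)\<close>. In the first case, iterating from \<open>u = 0\<close> contradicts the lower bound of the functional. In the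
  second, the step is cut off at large \<open>|u(0)|\<close> and iterated from all constants: the functional falls
  everywhere below its infimum over curves with \<open>u(0) = 0\<close>, but by Brouwer's theorem some iterate does
  satisfy \<open>u(0) = 0\<close>.\<close>

section \<open>Preliminaries\<close>

text \<open>The action is nonsmooth: the gradient of \<Phi> is given only for |u'| < a, and j may be
  infinite. A conditional gradient step asks only convexity of these two terms, and it keeps the
  constraints because it moves towards another admissible curve. The velocity of \<open>U u\<close>
  lies in the range of the inverse of \<phi>, the open ball, which gives |u'| < a at a fixed point.
  The penalty answers to directions in which j does not grow: for periodic conditions, j being the
  indicator of the diagonal, the linearised functional is affine along constants and in general
  unbounded below. The gradient of the penalty vanishes at z = u, so fixed points satisfy the
  original boundary condition. The obstacle is uniformity. \<Phi> is merely strictly convex, so the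
  decrease has no explicit modulus, and along a sequence of curves the velocities need not converge.
  The remedy is to bound the distance from u to \<open>U u\<close> by \<delta> plus a multiple of
  the rate of decrease, \<delta> being arbitrary; this survives uniform limits of curves. Finitely
  many discrete steps then play the part of a deformation flow.\<close>

lemma coercive_zero:
  fixes A :: "'a::euclidean_space \<Rightarrow> 'a"
  assumes cont: "continuous_on (cball 0 R) A" and "0 \<le> R"
    and pos: "\<And>x. norm x = R \<Longrightarrow> 0 < A x \<bullet> x"
  shows "\<exists>x\<in>cball 0 R. A x = 0"
proof (rule ccontr)
  assume "\<not> ?thesis"
  then have nz: "A x \<noteq> 0" if "x \<in> cball 0 R" for x
    using that by blast
  have "R \<noteq> 0" using pos[of 0] by auto
  with \<open>0 \<le> R\<close> have "0 < R" by simp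
  \<comment> \<open>A fixed point of this map has norm R and makes \<open>A x\<close> a negative
    multiple of x, against \<open>pos\<close>.\<close>
  define f where "f x = - ((R / norm (A x)) *\<^sub>R A x)" for x
  have "continuous_on (cball 0 R) f"
    unfolding f_def using nz by (intro continuous_intros cont) auto
  moreover have "f \<in> cball 0 R \<rightarrow> cball 0 R"
    unfolding f_def using nz \<open>0 < R\<close> by auto
  ultimately obtain x where x: "x \<in> cball 0 R" "f x = x"
    using brouwer_ball[OF \<open>0 < R\<close>] by blast
  have nx: "norm x = R"
    using nz[OF x(1)] \<open>0 < R\<close> by (subst x(2)[symmetric]) (simp add: f_def)
  have "x \<bullet> x = - (R / norm (A x)) * (A x \<bullet> x)"
    by (subst x(2)[symmetric]) (simp add: f_def)
  moreover have "0 \<le> R / norm (A x) * (A x \<bullet> x)"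
    using pos[OF nx] \<open>0 < R\<close> by simp
  moreover have "0 < x \<bullet> x" using nx \<open>0 < R\<close> by auto
  ultimately show False by linarith
qed

text \<open>A subsequence staying away from l would, by boundedness, contain a convergent one, whose
  limit must be l. This turns uniqueness of a solution into continuous dependence.\<close>

lemma tendsto_if_subseq_limits_eq:
  fixes X :: "nat \<Rightarrow> 'a::heine_borel"
  assumes bdd: "bounded (range X)"
    and uniq: "\<And>r L. strict_mono r \<Longrightarrow> (X \<circ> r) \<longlonglongrightarrow> L \<Longrightarrow> L = l"
  shows "X \<longlonglongrightarrow> l"
proof (rule ccontr)
  assume "\<not> X \<longlonglongrightarrow> l"
  then obtain e where e: "e > 0" "\<not> eventually (\<lambda>n. dist (X n) l < e) sequentially"
    unfolding tendsto_iff by blast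
  then have "\<exists>\<^sub>F n in sequentially. e \<le> dist (X n) l"
    by (simp add: frequently_def not_le)
  then have inf: "infinite {n. e \<le> dist (X n) l}"
    by (simp flip: frequently_cofinite add: cofinite_eq_sequentially)
  define r where "r = enumerate {n. e \<le> dist (X n) l}"
  have r: "strict_mono r" "\<And>n. e \<le> dist (X (r n)) l"
    using strict_mono_enumerate[OF inf] enumerate_in_set[OF inf] by (auto simp: r_def)
  have "bounded (range (X \<circ> r))"
    by (rule bounded_subset[OF bdd]) auto
  then obtain L s where s: "strict_mono s" "((X \<circ> r) \<circ> s) \<longlonglongrightarrow> L"
    using bounded_imp_convergent_subsequence[of "X \<circ> r"] by blast
  have "L = l"
    using uniq[of "r \<circ> s"] s r(1) by (simp add: strict_mono_o o_assoc)
  then have "eventually (\<lambda>n. dist (X (r (s n))) l < e) sequentially"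
    using s(2) \<open>e > 0\<close> by (auto simp: tendsto_iff)
  then show False
    using r(2) by (simp add: not_less[symmetric])
qed

lemma convex_combination_eq:
  fixes z z' :: "'a::real_vector"
  shows "(1 - s) *\<^sub>R z + s *\<^sub>R z' = z + s *\<^sub>R (z' - z)"
  by (simp add: algebra_simps)

section \<open>Uniform convergence under composition and integration\<close>

lemma uniform_limit_continuous_comp:
  fixes H :: "'c::metric_space \<Rightarrow> 'a::euclidean_space \<Rightarrow> 'b::metric_space"
  assumes S: "compact S" and H: "continuous_on (S \<times> UNIV) (\<lambda>(t, x). H t x)"
    and u: "continuous_on S u" and lim: "uniform_limit S f u F"
  shows "uniform_limit S (\<lambda>n t. H t (f n t)) (\<lambda>t. H t (u t)) F"
proof -
  obtain R where R: "\<And>t. t \<in> S \<Longrightarrow> norm (u t) \<le> R"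
    using compact_imp_bounded[OF compact_continuous_image[OF u S]] by (auto simp: bounded_iff)
  \<comment> \<open>Enlarging the radius by 1 makes this compact set contain the graph of every
    curve within distance 1 of u; on it \<open>H\<close> is uniformly continuous.\<close>
  define K where "K = S \<times> cball (0::'a) (R + 1)"
  have "compact K" unfolding K_def by (intro compact_Times S compact_cball)
  moreover have "continuous_on K (\<lambda>(t, x). H t x)"
    by (rule continuous_on_subset[OF H]) (auto simp: K_def)
  ultimately have uc: "uniformly_continuous_on K (\<lambda>(t, x). H t x)"
    by (simp add: compact_uniformly_continuous)
  show ?thesis
  proof (rule uniform_limitI)
    fix e :: real assume "e > 0"
    then obtain d where d: "d > 0" "\<And>p q. p \<in> K \<Longrightarrow> q \<in> K \<Longrightarrow> dist q p < d \<Longrightarrow>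
        dist ((\<lambda>(t, x). H t x) q) ((\<lambda>(t, x). H t x) p) < e"
      using uc unfolding uniformly_continuous_on_def by meson
    have "\<forall>\<^sub>F n in F. \<forall>t\<in>S. dist (f n t) (u t) < min d 1"
      using uniform_limitD[OF lim, of "min d 1"] d(1) by simp
    then show "\<forall>\<^sub>F n in F. \<forall>t\<in>S. dist (H t (f n t)) (H t (u t)) < e"
    proof (rule eventually_mono, intro ballI)
      fix n t assume *: "\<forall>t\<in>S. dist (f n t) (u t) < min d 1" and t: "t \<in> S"
      have "norm (f n t) \<le> norm (u t) + dist (f n t) (u t)"
        by (metis dist_norm norm_triangle_sub)
      also have "\<dots> \<le> R + 1" using R[OF t] * t by force
      finally have "(t, f n t) \<in> K" "(t, u t) \<in> K"
        using t R[OF t] by (auto simp: K_def)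
      moreover have "dist (t, f n t) (t, u t) < d"
        using * t by (simp add: dist_Pair_Pair)
      ultimately show "dist (H t (f n t)) (H t (u t)) < e"
        using d(2) by fastforce
    qed
  qed
qed

lemma uniform_limit_indefinite_integral:
  fixes f :: "'c \<Rightarrow> real \<Rightarrow> 'b::euclidean_space"
  assumes lim: "uniform_limit {a..b} f g F"
    and f: "\<And>n. continuous_on {a..b} (f n)" and g: "continuous_on {a..b} g"
  shows "uniform_limit {a..b} (\<lambda>n t. integral {a..t} (f n)) (\<lambda>t. integral {a..t} g) F"
proof (rule uniform_limitI)
  fix e :: real assume "e > 0"
  define d where "d = e / (\<bar>b - a\<bar> + 1)"
  have "d > 0" using \<open>e > 0\<close> by (simp add: d_def)
  from uniform_limitD[OF lim this]
  show "\<forall>\<^sub>F n in F. \<forall>t\<in>{a..b}. dist (integral {a..t} (f n)) (integral {a..t} g) < e"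
  proof (rule eventually_mono, intro ballI)
    fix n t assume *: "\<forall>t\<in>{a..b}. dist (f n t) (g t) < d" and t: "t \<in> {a..b}"
    have cf: "continuous_on {a..t} (f n)" and cg: "continuous_on {a..t} g"
      using t by (auto intro: continuous_on_subset[OF f] continuous_on_subset[OF g])
    have "integral {a..t} (f n) - integral {a..t} g = integral {a..t} (\<lambda>s. f n s - g s)"
      by (rule integral_diff[symmetric]) (auto intro: integrable_continuous_real cf cg)
    also have "norm \<dots> \<le> d * (t - a)"
    proof (rule integral_bound)
      fix s assume "s \<in> {a..t}"
      then show "norm (f n s - g s) \<le> d"
        using * t by (auto simp: dist_norm less_imp_le)
    qed (use t in \<open>auto intro!: continuous_intros cf cg\<close>)
    also have "\<dots> \<le> d * \<bar>b - a\<bar>"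
      using t \<open>d > 0\<close> by (intro mult_left_mono) auto
    also have "\<dots> < e"
      using \<open>e > 0\<close> by (simp add: d_def field_simps)
    finally show "dist (integral {a..t} (f n)) (integral {a..t} g) < e"
      by (simp add: dist_norm)
  qed
qed

section \<open>Gradients, subgradients and convexity\<close>

lemma GDERIV_line:
  assumes "GDERIV f (y + s *\<^sub>R h) :> g"
  shows "((\<lambda>s. f (y + s *\<^sub>R h)) has_real_derivative g \<bullet> h) (at s)"
proof -
  have 1: "((\<lambda>s. y + s *\<^sub>R h) has_derivative (\<lambda>s. s *\<^sub>R h)) (at s)"
    by (rule derivative_eq_intros refl | simp)+
  have 2: "(f has_derivative (\<lambda>k. k \<bullet> g)) (at (y + s *\<^sub>R h))"
    using assms unfolding gderiv_def .
  have "((\<lambda>s. f (y + s *\<^sub>R h)) has_derivative (\<lambda>r. (r *\<^sub>R h) \<bullet> g)) (at s)"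
    using has_derivative_compose[OF 1 2] .
  then show ?thesis
    unfolding has_field_derivative_def
    by (rule has_derivative_eq_rhs) (auto simp: inner_commute mult.commute)
qed

lemma gradient_increment_bound:
  fixes f :: "'a::euclidean_space \<Rightarrow> real"
  assumes grad: "\<And>x. GDERIV f x :> g x"
    and bound: "\<And>s. s \<in> {0..1} \<Longrightarrow> norm (g (y + s *\<^sub>R h) - g y) \<le> e"
  shows "f y + g y \<bullet> h - e * norm h \<le> f (y + h)"
proof -
  have der: "((\<lambda>s. f (y + s *\<^sub>R h)) has_real_derivative (g (y + s *\<^sub>R h) \<bullet> h)) (at s)" for s
    by (rule GDERIV_line) (rule grad)
  obtain s where s: "0 < s" "s < 1"
      "f (y + 1 *\<^sub>R h) - f (y + 0 *\<^sub>R h) = (1 - 0) * (g (y + s *\<^sub>R h) \<bullet> h)"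
    using MVT2[of 0 1 "\<lambda>s. f (y + s *\<^sub>R h)" "\<lambda>s. g (y + s *\<^sub>R h) \<bullet> h"] der by force
  have "g (y + s *\<^sub>R h) \<bullet> h = g y \<bullet> h + (g (y + s *\<^sub>R h) - g y) \<bullet> h"
    by (simp add: inner_diff_left)
  moreover have "\<bar>(g (y + s *\<^sub>R h) - g y) \<bullet> h\<bar> \<le> e * norm h"
    using Cauchy_Schwarz_ineq2 bound[of s] s(1,2)
    by (smt (verit) atLeastAtMost_iff mult_right_mono norm_ge_zero)
  ultimately show ?thesis using s(3) by simp
qed

lemma le_if_le_add_small:
  fixes A B C :: real
  assumes "\<And>t. 0 < t \<Longrightarrow> t < 1 \<Longrightarrow> A \<le> B + t * C"
  shows "A \<le> B"
proof -
  have "((\<lambda>t. B + t * C) \<longlongrightarrow> B + 0 * C) (at_right 0)"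
    by (intro tendsto_intros)
  moreover have "\<forall>\<^sub>F t in at_right (0::real). A \<le> B + t * C"
    using assms by (auto simp: eventually_at_right_field intro!: exI[of _ 1])
  ultimately show ?thesis
    by (intro tendsto_lowerbound[of _ _ "at_right (0::real)"]) auto
qed

lemma lower_semicont_eventually:
  fixes j :: "'a::topological_space \<Rightarrow> ereal"
  assumes "lower_semicont j" and "c < j z"
  shows "\<forall>\<^sub>F y in nhds z. c < j y"
proof -
  have "c < Liminf (at z) j"
    using assms unfolding lower_semicont_def by (metis less_le_trans)
  then have "\<forall>\<^sub>F y in at z. c < j y" by (rule less_LiminfD)
  then have "\<forall>\<^sub>F y in nhds z. y \<noteq> z \<longrightarrow> c < j y" by (simp add: eventually_at_filter)
  then show ?thesis by (rule eventually_mono) (use assms(2) in auto)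
qed

text \<open>The point z minimises j(y) + |y - q|^2 / 2: the quadratic term bounds a minimising
  sequence since j is nonnegative, and lower semicontinuity passes to the limit. Comparing z with
  the points of the segment from z to y yields the subgradient inequality.\<close>

lemma proximal_point_exists:
  fixes j :: "'a::euclidean_space \<Rightarrow> ereal"
  assumes lsc: "lower_semicont j" and conv: "econvex j"
    and nonneg: "\<And>z. 0 \<le> j z" and fin: "j z0 < \<infinity>"
  shows "\<exists>z. q - z \<in> subdifferential j z"
proof -
  define D where "D = eff_dom j"
  define J where "J y = real_of_ereal (j y)" for y
  have jJ: "j y = ereal (J y)" if "y \<in> D" for y
    using that nonneg[of y] by (auto simp: D_def eff_dom_def J_def ereal_real)
  have J0: "0 \<le> J y" for y using nonneg[of y] by (simp add: J_def real_of_ereal_pos)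
  have z0: "z0 \<in> D" using fin by (simp add: D_def eff_dom_def)
  define g where "g y = J y + (norm (y - q))\<^sup>2 / 2" for y
  have g0: "0 \<le> g y" for y using J0 by (simp add: g_def)
  define m where "m = (INF y\<in>D. g y)"
  have bdd: "bdd_below (g ` D)" using g0 by (intro bdd_belowI2[of _ 0])
  have m_le: "m \<le> g y" if "y \<in> D" for y
    unfolding m_def using bdd that by (rule cINF_lower)
  have "\<exists>y\<in>D. g y < m + 1 / Suc n" for n
    using cInf_lessD[of "g ` D" "m + 1 / Suc n"] z0 by (auto simp: m_def)
  then obtain Y where Y: "\<And>n. Y n \<in> D" "\<And>n. g (Y n) < m + 1 / Suc n" by metis
  have "norm (Y n - q) \<le> sqrt (2 * (m + 1))" for n
  proof -
    have "(norm (Y n - q))\<^sup>2 \<le> 2 * g (Y n)" using J0[of "Y n"] by (simp add: g_def)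
    also have "\<dots> \<le> 2 * (m + 1)"
      using Y(2)[of n] by (smt (verit) divide_le_eq_1_pos of_nat_0_less_iff of_nat_Suc of_nat_0_le_iff)
    finally show ?thesis by (rule real_le_rsqrt)
  qed
  then have "norm (Y n) \<le> sqrt (2 * (m + 1)) + norm q" for n
    by (smt (verit) norm_triangle_sub norm_minus_commute)
  then have "bounded (range Y)" by (auto simp: bounded_iff)
  then obtain z r where r: "strict_mono r" and lim: "(Y \<circ> r) \<longlonglongrightarrow> z"
    using bounded_imp_convergent_subsequence by blast
  have jz: "j z \<le> ereal (m - (norm (z - q))\<^sup>2 / 2)"
  proof (rule ccontr)
    assume "\<not> ?thesis"
    then obtain c where c: "m - (norm (z - q))\<^sup>2 / 2 < c" "ereal c < j z"
      by (metis ereal_dense2 ereal_less_eq(3) ereal_less(2) less_ereal.simps(1) not_le)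
    have "\<forall>\<^sub>F n in sequentially. ereal c < j ((Y \<circ> r) n)"
      using lower_semicont_eventually[OF lsc c(2)] lim by (auto simp: filterlim_iff)
    then have "\<forall>\<^sub>F n in sequentially. c + (norm ((Y \<circ> r) n - q))\<^sup>2 / 2 \<le> m + 1 / Suc (r n)"
    proof (rule eventually_mono)
      fix n assume "ereal c < j ((Y \<circ> r) n)"
      then have "c < J (Y (r n))" using jJ[OF Y(1)] by simp
      then show "c + (norm ((Y \<circ> r) n - q))\<^sup>2 / 2 \<le> m + 1 / Suc (r n)"
        using Y(2)[of "r n"] by (simp add: g_def)
    qed
    moreover have "(\<lambda>n. c + (norm ((Y \<circ> r) n - q))\<^sup>2 / 2) \<longlonglongrightarrow> c + (norm (z - q))\<^sup>2 / 2"
      by (intro tendsto_intros lim) simp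
    moreover have "(\<lambda>n. m + 1 / Suc (r n)) \<longlonglongrightarrow> m + 0"
      using LIMSEQ_subseq_LIMSEQ[OF LIMSEQ_inverse_real_of_nat r]
      by (intro tendsto_intros) (simp add: inverse_eq_divide o_def)
    ultimately have "c + (norm (z - q))\<^sup>2 / 2 \<le> m + 0"
      by (intro tendsto_le[of sequentially]) auto
    with c(1) show False by simp
  qed
  then have zD: "z \<in> D" by (auto simp: D_def eff_dom_def)
  have gz: "g z \<le> m" using jz jJ[OF zD] by (simp add: g_def)
  have "J z + (q - z) \<bullet> (y - z) \<le> J y" if y: "y \<in> D" for y
  proof -
    \<comment> \<open>This is minimality along the segment, divided by t. The last term stems from
      the square of the displacement and vanishes as t tends to 0.\<close>
    have "J z \<le> J y + (z - q) \<bullet> (y - z) + t * ((norm (y - z))\<^sup>2 / 2)" if t: "0 < t" "t < 1" for t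
    proof -
      define x where "x = (1 - t) *\<^sub>R z + t *\<^sub>R y"
      have "j x \<le> ereal (1 - t) * j z + ereal t * j y"
        using conv t by (auto simp: econvex_def x_def)
      also have "\<dots> = ereal ((1 - t) * J z + t * J y)"
        by (simp add: jJ zD y)
      finally have jx: "j x \<le> ereal ((1 - t) * J z + t * J y)" .
      then have xD: "x \<in> D" by (auto simp: D_def eff_dom_def)
      have Jx: "J x \<le> (1 - t) * J z + t * J y" using jx jJ[OF xD] by simp
      have xq: "x - q = (z - q) + t *\<^sub>R (y - z)" by (simp add: x_def algebra_simps)
      have nx: "(norm (x - q))\<^sup>2 = (norm (z - q))\<^sup>2 + 2 * t * ((z - q) \<bullet> (y - z)) + t\<^sup>2 * (norm (y - z))\<^sup>2"
        unfolding xq power2_norm_eq_inner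
        by (simp add: inner_add_left inner_add_right inner_commute power2_eq_square)
      have "g z \<le> g x" using gz m_le[OF xD] by simp
      then have "t * J z \<le> t * (J y + (z - q) \<bullet> (y - z) + t * ((norm (y - z))\<^sup>2 / 2))"
        using Jx nx unfolding g_def by (simp add: algebra_simps power2_eq_square)
      then show ?thesis using t by simp
    qed
    then have "J z \<le> J y + (z - q) \<bullet> (y - z)" by (rule le_if_le_add_small)
    then show ?thesis by (simp add: inner_diff_left algebra_simps)
  qed
  then have "j z + ereal ((q - z) \<bullet> (y - z)) \<le> j y" for y
    by (cases "y \<in> D") (auto simp: jJ zD, auto simp: D_def eff_dom_def)
  then show ?thesis by (auto simp: subdifferential_def)
qed

text \<open>The weak inequality is a limit of difference quotients. Strictness comes from applying
  it at the midpoint m, where f lies strictly below the chord.\<close>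

lemma strictly_convex_on_gradient:
  assumes conv: "strictly_convex_on S f" and grad: "GDERIV f x :> g"
    and S: "x \<in> S" "y \<in> S" and ne: "x \<noteq> y"
  shows "f x + g \<bullet> (y - x) < f y"
proof -
  have le: "f x + g \<bullet> (y - x) \<le> f y" if y: "y \<in> S" "x \<noteq> y" for y
  proof -
    have "((\<lambda>s. f (x + s *\<^sub>R (y - x))) has_real_derivative g \<bullet> (y - x)) (at 0)"
      by (rule GDERIV_line) (use grad in simp)
    then have "((\<lambda>s. (f (x + s *\<^sub>R (y - x)) - f x) / s) \<longlongrightarrow> g \<bullet> (y - x)) (at_right 0)"
      by (auto simp: has_field_derivative_iff intro: tendsto_mono at_le)
    moreover have "(f (x + s *\<^sub>R (y - x)) - f x) / s \<le> f y - f x" if s: "0 < s" "s < 1" for s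
    proof -
      have "x + s *\<^sub>R (y - x) = (1 - s) *\<^sub>R x + s *\<^sub>R y" by (simp add: algebra_simps)
      then have "f (x + s *\<^sub>R (y - x)) < (1 - s) * f x + s * f y"
        using conv S(1) y s unfolding strictly_convex_on_def by metis
      then have "f (x + s *\<^sub>R (y - x)) - f x \<le> (f y - f x) * s"
        by (simp add: algebra_simps)
      then show ?thesis using s by (simp add: pos_divide_le_eq)
    qed
    then have "\<forall>\<^sub>F s in at_right 0. (f (x + s *\<^sub>R (y - x)) - f x) / s \<le> f y - f x"
      by (auto simp: eventually_at_right_field intro!: exI[of _ 1])
    ultimately have "g \<bullet> (y - x) \<le> f y - f x"
      by (rule tendsto_upperbound) simp
    then show ?thesis by simp
  qed
  define m where "m = (1 - 1/2) *\<^sub>R x + (1/2::real) *\<^sub>R y"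
  have m1: "m \<in> S" 
    using conv S unfolding strictly_convex_on_def m_def by (intro convexD_alt) auto
  have m2: "f m < (1 - 1/2) * f x + 1/2 * f y"
    using conv S ne unfolding strictly_convex_on_def m_def
    by (metis half_gt_zero_iff less_numeral_extra(1) half_bounded_equal field_sum_of_halves less_add_same_cancel1)
  have mx: "m - x = (1/2) *\<^sub>R (y - x)"
    by (simp add: m_def algebra_simps) (simp flip: scaleR_left_distrib)
  then have "x \<noteq> m" using ne by auto
  from le[OF m1 this] have "f x + 1/2 * (g \<bullet> (y - x)) \<le> f m" by (simp add: mx)
  with m2 show ?thesis by simp
qed

text \<open>Only the compact set where e is at least \<delta> matters. There d has a positive
  minimum \<open>d p0\<close> and e is at most B, hence C = B / d p0. This stands in for an explicit
  modulus of strict convexity.\<close>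

lemma compact_modulus:
  fixes d e :: "'a::topological_space \<Rightarrow> real"
  assumes Z: "compact Z" and d: "continuous_on Z d" and e: "continuous_on Z e"
    and nonneg: "\<And>p. p \<in> Z \<Longrightarrow> 0 \<le> d p"
    and null: "\<And>p. p \<in> Z \<Longrightarrow> d p = 0 \<Longrightarrow> e p \<le> 0"
    and "0 < \<delta>"
  shows "\<exists>C\<ge>0. \<forall>p\<in>Z. e p \<le> \<delta> + C * d p"
proof -
  obtain B where B: "\<And>p. p \<in> Z \<Longrightarrow> \<bar>e p\<bar> \<le> B" 
    using compact_imp_bounded[OF compact_continuous_image[OF e Z]] by (auto simp: bounded_iff)
  define Z' where "Z' = {p \<in> Z. \<delta> \<le> e p}"
  have Z': "compact Z'"
  proof -
    have "Z' = Z \<inter> e -` {\<delta>..}" by (auto simp: Z'_def)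
    moreover obtain U where "closed U" "U \<inter> Z = e -` {\<delta>..} \<inter> Z"
      using e continuous_on_closed_invariant[of Z e] closed_atLeast by meson
    ultimately have "Z' = Z \<inter> U" by auto
    then show ?thesis using Z \<open>closed U\<close> compact_Int_closed by simp
  qed
  show ?thesis
  proof (cases "Z' = {}")
    case True
    then show ?thesis by (intro exI[of _ 0]) (force simp: Z'_def)
  next
    case False
    then obtain p0 where p0: "p0 \<in> Z'" "\<And>p. p \<in> Z' \<Longrightarrow> d p0 \<le> d p"
      using continuous_attains_inf[OF Z' False continuous_on_subset[OF d]] by (auto simp: Z'_def)
    have "d p0 \<noteq> 0" using p0(1) null[of p0] \<open>0 < \<delta>\<close> by (auto simp: Z'_def)
    then have dp0: "d p0 > 0" using nonneg[of p0] p0(1) by (auto simp: Z'_def)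
    have B0: "0 \<le> B" using B[of p0] p0(1) by (auto simp: Z'_def)
    have "e p \<le> \<delta> + B / d p0 * d p" if p: "p \<in> Z" for p
    proof (cases "p \<in> Z'")
      case True
      have "B * 1 \<le> B * (d p / d p0)"
        using p0(2)[OF True] dp0 B0 by (intro mult_left_mono) auto
      then show ?thesis using B[OF p] \<open>0 < \<delta>\<close> by (simp add: field_simps)
    next
      case False
      then have "e p \<le> \<delta>" using p by (auto simp: Z'_def)
      moreover have "0 \<le> B / d p0 * d p" using B0 dp0 nonneg[OF p] by simp
      ultimately show ?thesis by simp
    qed
    then show ?thesis using B0 dp0 by (intro exI[of _ "B / d p0"]) auto
  qed
qed

lemma uniform_limit_tendsto_const:
  "(f \<longlongrightarrow> c) F \<Longrightarrow> uniform_limit S (\<lambda>n t. f n) (\<lambda>t. c) F"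
  by (auto simp: uniform_limit_iff tendsto_iff elim: eventually_mono)

lemma uniform_limit_subseq:
  assumes "uniform_limit S f g sequentially" and "strict_mono r"
  shows "uniform_limit S (\<lambda>n. f (r n)) g sequentially"
proof (rule uniform_limitI)
  fix e :: real assume "e > 0"
  show "\<forall>\<^sub>F n in sequentially. \<forall>x\<in>S. dist (f (r n) x) (g x) < e"
    using eventually_subseq[OF assms(2) uniform_limitD[OF assms(1) \<open>e > 0\<close>]] .
qed

section \<open>The linearised problem\<close>

text \<open>\<open>\<psi>\<close> is the inverse of \<open>\<phi>\<close>, \<open>D\<close> and \<open>J\<close> are the effective domain of \<open>j\<close> and its real-valued
  restriction, and \<open>prox\<close> is the proximal map of \<open>j\<close>, i.e. the resolvent of \<open>\<partial>j\<close>.\<close>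

locale relativistic_bvp =
  fixes T a :: real
    and \<psi> :: "'a::euclidean_space \<Rightarrow> 'a" and \<Phi> :: "'a \<Rightarrow> real"
    and F :: "real \<Rightarrow> 'a \<Rightarrow> real" and G :: "real \<Rightarrow> 'a \<Rightarrow> 'a"
    and D :: "('a \<times> 'a) set" and J :: "'a \<times> 'a \<Rightarrow> real" and prox :: "'a \<times> 'a \<Rightarrow> 'a \<times> 'a"
  assumes T: "0 < T" and a: "0 < a"
    and psi_cont: "continuous_on UNIV \<psi>" and psi_inj: "inj \<psi>" and psi_less: "norm (\<psi> w) < a"
    and Phi_cont: "continuous_on (cball 0 a) \<Phi>"
    and Phi_nonpos: "v \<in> cball 0 a \<Longrightarrow> \<Phi> v \<le> 0"
    and Phi_min: "v \<in> cball 0 a \<Longrightarrow> \<Phi> 0 \<le> \<Phi> v"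
    and Phi_convex: "\<lbrakk>v \<in> cball 0 a; v' \<in> cball 0 a; 0 \<le> s; s \<le> 1\<rbrakk> \<Longrightarrow>
          \<Phi> ((1 - s) *\<^sub>R v + s *\<^sub>R v') \<le> (1 - s) * \<Phi> v + s * \<Phi> v'"
    and Phi_subgrad: "\<lbrakk>v \<in> cball 0 a; v \<noteq> \<psi> w\<rbrakk> \<Longrightarrow> \<Phi> (\<psi> w) + w \<bullet> (v - \<psi> w) < \<Phi> v"
    and F_cont: "continuous_on ({0..T} \<times> UNIV) (\<lambda>(t, x). F t x)"
    and F_grad: "t \<in> {0..T} \<Longrightarrow> GDERIV (F t) x :> G t x"
    and G_cont: "continuous_on ({0..T} \<times> UNIV) (\<lambda>(t, x). G t x)"
    and J_0: "(0, 0) \<in> D" "J (0, 0) = 0" and J_nonneg: "z \<in> D \<Longrightarrow> 0 \<le> J z"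
    and D_convex: "\<lbrakk>z \<in> D; z' \<in> D; 0 \<le> s; s \<le> 1\<rbrakk> \<Longrightarrow> (1 - s) *\<^sub>R z + s *\<^sub>R z' \<in> D"
    and J_convex: "\<lbrakk>z \<in> D; z' \<in> D; 0 \<le> s; s \<le> 1\<rbrakk> \<Longrightarrow>
          J ((1 - s) *\<^sub>R z + s *\<^sub>R z') \<le> (1 - s) * J z + s * J z'"
    and prox_in: "prox q \<in> D"
    and prox_subgrad: "z \<in> D \<Longrightarrow> J (prox q) + (q - prox q) \<bullet> (z - prox q) \<le> J z"
begin

section \<open>Monotonicity and growth of \<open>prox\<close> and \<open>\<psi>\<close>\<close>

lemma prox_inner_ge: "(norm (prox q))\<^sup>2 \<le> q \<bullet> prox q"
  using prox_subgrad[OF J_0(1), of q] J_nonneg[OF prox_in, of q] J_0(2)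
  by (simp add: zero_prod_def[symmetric] inner_diff_left power2_norm_eq_inner)

text \<open>Adding the subgradient inequalities at \<open>prox q\<close> and \<open>prox q'\<close>
  cancels the values of \<open>J\<close>.\<close>

lemma prox_firmly_nonexpansive: "(norm (prox q - prox q'))\<^sup>2 \<le> (q - q') \<bullet> (prox q - prox q')"
  using prox_subgrad[OF prox_in, of q q'] prox_subgrad[OF prox_in, of q' q]
  unfolding power2_norm_eq_inner
  by (simp add: inner_diff_left inner_diff_right inner_commute)

lemma prox_nonexpansive: "norm (prox q - prox q') \<le> norm (q - q')"
proof -
  have "norm (prox q - prox q') * norm (prox q - prox q') \<le> norm (q - q') * norm (prox q - prox q')"
    using prox_firmly_nonexpansive[of q q'] norm_cauchy_schwarz[of "q - q'" "prox q - prox q'"]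
    by (simp add: power2_eq_square)
  then show ?thesis
    by (cases "prox q = prox q'") auto
qed

lemma prox_continuous: "continuous_on UNIV prox"
  unfolding continuous_on_iff
  by (metis dist_norm order_le_less_trans prox_nonexpansive)

lemma prox_norm_le: "norm (prox q) \<le> norm q"
proof -
  have "norm (prox q) * norm (prox q) \<le> norm q * norm (prox q)"
    using prox_inner_ge[of q] norm_cauchy_schwarz[of q "prox q"] by (simp add: power2_eq_square)
  then show ?thesis
    by (cases "prox q = 0") auto
qed

lemma Phi_subgrad_le: "v \<in> cball 0 a \<Longrightarrow> \<Phi> (\<psi> w) + w \<bullet> (v - \<psi> w) \<le> \<Phi> v"
  using Phi_subgrad[of v w] by (cases "v = \<psi> w") auto

lemma psi_in: "\<psi> w \<in> cball 0 a"
  using psi_less[of w] by simp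

lemma psi_strictly_monotone:
  assumes "w \<noteq> w'" shows "0 < (w - w') \<bullet> (\<psi> w - \<psi> w')"
proof -
  have "\<psi> w \<noteq> \<psi> w'" using assms psi_inj by (auto dest: injD)
  then show ?thesis
    using Phi_subgrad[OF psi_in, of w w'] Phi_subgrad[OF psi_in, of w' w]
    by (simp add: inner_diff_left inner_diff_right inner_commute)
qed

text \<open>The subgradient inequality at \<open>\<psi> w\<close> is tested with the point v of norm
  a in the direction of w. There \<Phi> is nonpositive, while \<Phi> at \<open>\<psi> w\<close> is
  at least \<open>\<Phi> 0\<close>.\<close>

lemma psi_coercive: "a * norm w + \<Phi> 0 \<le> w \<bullet> \<psi> w"
proof (cases "w = 0")
  case True
  then show ?thesis using Phi_nonpos[of 0] a by simp
next
  case False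
  define v where "v = (a / norm w) *\<^sub>R w"
  have v: "v \<in> cball 0 a" using False a by (simp add: v_def)
  have "w \<bullet> v = a * norm w"
    using False by (simp add: v_def power2_norm_eq_inner[symmetric] power2_eq_square)
  then show ?thesis
    using Phi_subgrad_le[OF v, of w] Phi_nonpos[OF v] Phi_min[OF psi_in, of w]
    by (simp add: inner_diff_right)
qed

text \<open>Freezing the nonlinearity at a curve \<open>u\<close> leaves \<open>-\<phi>(z')' = G(t,u)\<close>, whose solutions satisfy
  \<open>\<phi>(z') = p + W u\<close> with a constant \<open>p\<close>. The boundary condition is penalised by the squared
  distance of the end points of \<open>z\<close> from those of \<open>u\<close>, so that the end points of \<open>z\<close> are the
  explicit function \<open>bdry u p\<close> of \<open>p\<close>. What remains is one equation in \<open>p\<close>, namely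
  \<open>shoot u p = 0\<close>.\<close>

definition W :: "(real \<Rightarrow> 'a) \<Rightarrow> real \<Rightarrow> 'a" where
  "W u t = - integral {0..t} (\<lambda>s. G s (u s))"

definition bdry :: "(real \<Rightarrow> 'a) \<Rightarrow> 'a \<Rightarrow> 'a \<times> 'a" where
  "bdry u p = prox (p + u 0, (u T - W u T) - p)"

definition shoot :: "(real \<Rightarrow> 'a) \<Rightarrow> 'a \<Rightarrow> 'a" where
  "shoot u p = integral {0..T} (\<lambda>t. \<psi> (p + W u t)) - (snd (bdry u p) - fst (bdry u p))"

section \<open>Solvability of the shooting equation\<close>

lemma continuous_G: "continuous_on {0..T} u \<Longrightarrow> continuous_on {0..T} (\<lambda>s. G s (u s))"
  by (rule continuous_on_compose2[OF G_cont, of _ "\<lambda>s. (s, u s)", simplified]) (auto intro!: continuous_on_Pair)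

lemma continuous_F: "continuous_on {0..T} u \<Longrightarrow> continuous_on {0..T} (\<lambda>s. F s (u s))"
  by (rule continuous_on_compose2[OF F_cont, of _ "\<lambda>s. (s, u s)", simplified]) (auto intro!: continuous_on_Pair)

lemma continuous_psi: "continuous_on S w \<Longrightarrow> continuous_on S (\<lambda>s. \<psi> (w s))"
  by (rule continuous_on_compose2[OF psi_cont]) auto

lemma continuous_W: "continuous_on {0..T} u \<Longrightarrow> continuous_on {0..T} (W u)"
  unfolding W_def
  by (intro continuous_on_minus indefinite_integral_continuous_1 integrable_continuous_real continuous_G)

lemma continuous_psi_W: "continuous_on {0..T} u \<Longrightarrow> continuous_on {0..T} (\<lambda>t. \<psi> (p + W u t))"
  by (intro continuous_psi continuous_on_add continuous_on_const continuous_W)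

text \<open>Since p enters the two arguments of \<open>prox\<close> with opposite signs,
  \<open>prox_inner_ge\<close> produces exactly the product of x - y with p. The other cross terms
  are absorbed by the squares, at a cost of at most M^2 / 2 for each end point.\<close>

lemma bdry_inner_ge:
  assumes "norm (u 0) \<le> M" "norm (u T - W u T) \<le> M"
  shows "- (M\<^sup>2) \<le> (fst (bdry u p) - snd (bdry u p)) \<bullet> p"
proof -
  define x y where "x = fst (bdry u p)" and "y = snd (bdry u p)"
  define b where "b = u T - W u T"
  have sq: "- ((norm c)\<^sup>2) / 2 \<le> (norm z)\<^sup>2 - z \<bullet> c" for z c :: 'a
  proof -
    have "z \<bullet> c \<le> norm z * norm c" by (rule norm_cauchy_schwarz)
    moreover have "0 \<le> (norm z - norm c / 2)\<^sup>2" by simp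
    then have "norm z * norm c \<le> (norm z)\<^sup>2 + (norm c)\<^sup>2 / 4"
      by (simp add: power2_eq_square algebra_simps)
    moreover have "0 \<le> (norm c)\<^sup>2" by simp
    ultimately show ?thesis by linarith
  qed
  have "(x, y) = prox (p + u 0, b - p)" by (simp add: x_def y_def b_def bdry_def)
  then have "(norm (x, y))\<^sup>2 \<le> (p + u 0, b - p) \<bullet> (x, y)" using prox_inner_ge by metis
  then have "(norm x)\<^sup>2 + (norm y)\<^sup>2 \<le> (p + u 0) \<bullet> x + (b - p) \<bullet> y"
    by (simp add: norm_Pair)
  then have "(norm x)\<^sup>2 - x \<bullet> u 0 + ((norm y)\<^sup>2 - y \<bullet> b) \<le> (x - y) \<bullet> p"
    by (simp add: algebra_simps inner_commute)
  moreover have "(norm (u 0))\<^sup>2 \<le> M\<^sup>2" "(norm b)\<^sup>2 \<le> M\<^sup>2"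
    using assms by (auto simp: b_def intro: power_mono)
  ultimately show ?thesis
    using sq[of "u 0" x] sq[of b y] unfolding x_def y_def by linarith
qed

text \<open>\<open>psi_coercive\<close> is applied at \<open>p + W u t\<close>. Passing to p costs
  \<open>a * M\<close> in the norm and another \<open>a * M\<close> in the inner product; the
  boundary part costs M^2.\<close>

lemma shoot_inner_ge:
  assumes u: "continuous_on {0..T} u"
    and M: "norm (u 0) \<le> M" "norm (u T - W u T) \<le> M" "\<And>t. t \<in> {0..T} \<Longrightarrow> norm (W u t) \<le> M"
  shows "T * (a * norm p - 2 * a * M + \<Phi> 0) - M\<^sup>2 \<le> shoot u p \<bullet> p"
proof -
  have pw: "a * norm p - 2 * a * M + \<Phi> 0 \<le> \<psi> (p + W u t) \<bullet> p" if t: "t \<in> {0..T}" for t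
  proof -
    have "a * norm (p + W u t) + \<Phi> 0 \<le> \<psi> (p + W u t) \<bullet> p + \<psi> (p + W u t) \<bullet> W u t"
      using psi_coercive[of "p + W u t"] by (simp add: inner_add_left inner_commute)
    moreover have "\<psi> (p + W u t) \<bullet> W u t \<le> a * M"
      using norm_cauchy_schwarz[of "\<psi> (p + W u t)" "W u t"]
        mult_mono[OF less_imp_le[OF psi_less] M(3)[OF t], of "p + W u t"] a by simp
    moreover have "a * (norm p - M) \<le> a * norm (p + W u t)"
      using a M(3)[OF t] norm_diff_triangle_ineq[of p 0 "- W u t" 0] norm_triangle_ineq4[of "p + W u t" "W u t"]
      by (intro mult_left_mono) auto
    ultimately show ?thesis by (simp add: algebra_simps)
  qed
  have c: "continuous_on {0..T} (\<lambda>t. \<psi> (p + W u t))" by (rule continuous_psi_W[OF u])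
  have "T * (a * norm p - 2 * a * M + \<Phi> 0) = integral {0..T} (\<lambda>t. a * norm p - 2 * a * M + \<Phi> 0)"
    using T by simp
  also have "\<dots> \<le> integral {0..T} (\<lambda>t. \<psi> (p + W u t) \<bullet> p)"
    by (intro integral_le integrable_continuous_real continuous_intros c pw)
  also have "\<dots> = integral {0..T} (\<lambda>t. \<psi> (p + W u t)) \<bullet> p"
    using integral_linear[OF integrable_continuous_real[OF c] bounded_linear_inner_left[of p]]
    by (simp add: o_def)
  finally show ?thesis
    using bdry_inner_ge[OF M(1,2), of p] by (simp add: shoot_def inner_diff_left)
qed

text \<open>In the product of p - q with the difference of the two values, the integral part is
  strictly positive because \<open>\<psi>\<close> is strictly monotone. The boundary part has the
  same sign because \<open>prox\<close> is monotone and p enters it as (p, -p).\<close>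

lemma shoot_strictly_monotone:
  assumes u: "continuous_on {0..T} u" and ne: "p \<noteq> q"
  shows "shoot u p \<noteq> shoot u q"
proof
  assume eq: "shoot u p = shoot u q"
  define x y x' y' where "x = fst (bdry u p)" and "y = snd (bdry u p)"
    and "x' = fst (bdry u q)" and "y' = snd (bdry u q)"
  have "0 \<le> ((p + u 0, (u T - W u T) - p) - (q + u 0, (u T - W u T) - q)) \<bullet> (bdry u p - bdry u q)"
    unfolding bdry_def by (rule order_trans[OF zero_le_power2 prox_firmly_nonexpansive])
  then have le: "(p - q) \<bullet> ((y - x) - (y' - x')) \<le> 0"
    by (simp add: x_def y_def x'_def y'_def inner_prod_def algebra_simps)
  have cont: "continuous_on {0..T} (\<lambda>t. \<psi> (r + W u t))" for r by (rule continuous_psi_W[OF u])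
  define f where "f t = (p - q) \<bullet> (\<psi> (p + W u t) - \<psi> (q + W u t))" for t
  have cf: "continuous_on {0..T} f" unfolding f_def by (intro continuous_intros cont)
  have fpos: "0 < f t" for t
    using psi_strictly_monotone[of "p + W u t" "q + W u t"] ne by (simp add: f_def)
  have "(y - x) - (y' - x') = integral {0..T} (\<lambda>t. \<psi> (p + W u t)) - integral {0..T} (\<lambda>t. \<psi> (q + W u t))"
    using eq by (simp add: shoot_def x_def y_def x'_def y'_def algebra_simps)
  then have "(p - q) \<bullet> ((y - x) - (y' - x')) =
      (p - q) \<bullet> (integral {0..T} (\<lambda>t. \<psi> (p + W u t)) - integral {0..T} (\<lambda>t. \<psi> (q + W u t)))"
    by simp
  also have "\<dots> = (p - q) \<bullet> integral {0..T} (\<lambda>t. \<psi> (p + W u t) - \<psi> (q + W u t))"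
    by (subst integral_diff) (auto intro: integrable_continuous_real cont)
  also have "\<dots> = integral {0..T} f"
    using integral_linear[OF integrable_continuous_real bounded_linear_inner_right[of "p - q"],
        of 0 T "\<lambda>t. \<psi> (p + W u t) - \<psi> (q + W u t)"]
    by (simp add: o_def f_def[abs_def] continuous_on_diff cont)
  finally have "(p - q) \<bullet> ((y - x) - (y' - x')) = integral {0..T} f" .
  moreover have "0 < integral {0..T} f"
    using integral_less_real[of 0 T "\<lambda>t. 0" f] cf fpos T by simp
  ultimately show False using le by simp
qed


text \<open>\<open>U u\<close> is the solution of the linearised problem, with initial value \<open>X u\<close> and velocity \<open>V u\<close>.
  Fixed points of \<open>U\<close> solve the original problem.\<close>

definition P :: "(real \<Rightarrow> 'a) \<Rightarrow> 'a" where
  "P u = (THE p. shoot u p = 0)"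

definition X :: "(real \<Rightarrow> 'a) \<Rightarrow> 'a" where
  "X u = fst (bdry u (P u))"

definition V :: "(real \<Rightarrow> 'a) \<Rightarrow> real \<Rightarrow> 'a" where
  "V u t = \<psi> (P u + W u t)"

definition U :: "(real \<Rightarrow> 'a) \<Rightarrow> real \<Rightarrow> 'a" where
  "U u t = X u + integral {0..t} (V u)"

section \<open>Continuity of the shooting function in the curve and the parameter jointly\<close>

context
  fixes f :: "nat \<Rightarrow> real \<Rightarrow> 'a" and u :: "real \<Rightarrow> 'a"
  assumes f: "\<And>n. continuous_on {0..T} (f n)" and u: "continuous_on {0..T} u"
    and lim: "uniform_limit {0..T} f u sequentially"
begin

lemma W_uniform_limit: "uniform_limit {0..T} (\<lambda>n. W (f n)) (W u) sequentially"
proof -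
  have "uniform_limit {0..T} (\<lambda>n t. G t (f n t)) (\<lambda>t. G t (u t)) sequentially"
    by (rule uniform_limit_continuous_comp[OF compact_Icc G_cont u lim])
  then show ?thesis
    unfolding W_def
    by (intro uniform_limit_uminus uniform_limit_indefinite_integral continuous_G f u)
qed

lemma psi_W_uniform_limit:
  assumes "p \<longlonglongrightarrow> p0"
  shows "uniform_limit {0..T} (\<lambda>n t. \<psi> (p n + W (f n) t)) (\<lambda>t. \<psi> (p0 + W u t)) sequentially"
proof (rule uniform_limit_continuous_comp[where H = "\<lambda>t. \<psi>" and u = "\<lambda>t. p0 + W u t"
      and f = "\<lambda>n t. p n + W (f n) t"])
  show "continuous_on ({0..T} \<times> UNIV) (\<lambda>(t, x). \<psi> x)"
    unfolding split_beta by (intro continuous_psi continuous_on_snd continuous_on_id)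
  show "uniform_limit {0..T} (\<lambda>n t. p n + W (f n) t) (\<lambda>t. p0 + W u t) sequentially"
    by (intro uniform_limit_add uniform_limit_tendsto_const assms W_uniform_limit)
qed (auto intro!: continuous_intros continuous_W u)

lemma bdry_tendsto:
  assumes "p \<longlonglongrightarrow> p0"
  shows "(\<lambda>n. bdry (f n) (p n)) \<longlonglongrightarrow> bdry u p0"
proof -
  have at: "(\<lambda>n. f n t) \<longlonglongrightarrow> u t" "(\<lambda>n. W (f n) t) \<longlonglongrightarrow> W u t" if "t \<in> {0..T}" for t
    using tendsto_uniform_limitI[OF lim that] tendsto_uniform_limitI[OF W_uniform_limit that] by auto
  show ?thesis
    unfolding bdry_def
    by (rule continuous_on_tendsto_compose[OF prox_continuous])
      (use T in \<open>auto intro!: tendsto_intros at assms\<close>)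
qed

lemma shoot_tendsto:
  assumes "p \<longlonglongrightarrow> p0"
  shows "(\<lambda>n. shoot (f n) (p n)) \<longlonglongrightarrow> shoot u p0"
proof -
  have "uniform_limit {0..T} (\<lambda>n t. integral {0..t} (\<lambda>t. \<psi> (p n + W (f n) t)))
      (\<lambda>t. integral {0..t} (\<lambda>t. \<psi> (p0 + W u t))) sequentially"
    by (intro uniform_limit_indefinite_integral psi_W_uniform_limit assms continuous_psi_W f u)
  then have "(\<lambda>n. integral {0..T} (\<lambda>t. \<psi> (p n + W (f n) t))) \<longlonglongrightarrow> integral {0..T} (\<lambda>t. \<psi> (p0 + W u t))"
    by (rule tendsto_uniform_limitI) (use T in auto)
  then show ?thesis
    unfolding shoot_def by (intro tendsto_intros bdry_tendsto assms)
qed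

end

lemma shoot_continuous: "continuous_on {0..T} u \<Longrightarrow> continuous_on S (shoot u)"
  using shoot_tendsto[of "\<lambda>n. u" u] by (simp add: continuous_on_sequentially o_def uniform_limit_iff)

section \<open>A priori bounds and continuous dependence for the linearised problem\<close>

lemma curve_bound:
  "\<exists>M\<ge>0. \<forall>u. continuous_on {0..T} u \<and> (\<forall>t\<in>{0..T}. norm (u t) \<le> R) \<longrightarrow>
     norm (u 0) \<le> M \<and> norm (u T - W u T) \<le> M \<and> (\<forall>t\<in>{0..T}. norm (W u t) \<le> M)"
proof -
  define K where "K = {0..T} \<times> cball (0::'a) R"
  have "compact K" unfolding K_def by (intro compact_Times compact_Icc compact_cball)
  moreover have "continuous_on K (\<lambda>(t, x). G t x)"
    by (rule continuous_on_subset[OF G_cont]) (auto simp: K_def)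
  ultimately have "bounded ((\<lambda>(t, x). G t x) ` K)"
    by (intro compact_imp_bounded compact_continuous_image)
  then obtain B where B: "0 < B" "\<And>t x. (t, x) \<in> K \<Longrightarrow> norm (G t x) \<le> B"
    by (force simp: bounded_pos)
  define M where "M = \<bar>R\<bar> + B * T"
  have "norm (u 0) \<le> M \<and> norm (u T - W u T) \<le> M \<and> (\<forall>t\<in>{0..T}. norm (W u t) \<le> M)"
    if u: "continuous_on {0..T} u" "\<forall>t\<in>{0..T}. norm (u t) \<le> R" for u
  proof -
    have W: "norm (W u t) \<le> B * T" if t: "t \<in> {0..T}" for t
    proof -
      have "norm (W u t) \<le> B * (t - 0)"
        unfolding W_def norm_minus_cancel
        using t u(2) continuous_on_subset[OF continuous_G[OF u(1)], of "{0..t}"]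
        by (intro integral_bound B) (auto simp: K_def)
      also have "\<dots> \<le> B * T" using B(1) t by (intro mult_left_mono) auto
      finally show ?thesis .
    qed
    moreover have "norm (u 0) \<le> R" "norm (u T) \<le> R" using u(2) T by auto
    moreover have "norm (u T - W u T) \<le> norm (u T) + norm (W u T)" by (rule norm_triangle_ineq4)
    moreover have "0 \<le> B * T" using B(1) T by simp
    moreover have "norm (W u T) \<le> B * T" using W T by simp
    ultimately show ?thesis unfolding M_def by force
  qed
  moreover have "0 \<le> M" using B(1) T by (simp add: M_def)
  ultimately show ?thesis by blast
qed

lemma shoot_zero_bound:
  "\<exists>B\<ge>0. \<forall>u. continuous_on {0..T} u \<and> (\<forall>t\<in>{0..T}. norm (u t) \<le> R) \<longrightarrow>
     (\<exists>p. shoot u p = 0) \<and> (\<forall>p. shoot u p = 0 \<longrightarrow> norm p \<le> B \<and> norm (bdry u p) \<le> B)"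
proof -
  obtain M where M: "0 \<le> M" "\<And>u. continuous_on {0..T} u \<Longrightarrow> \<forall>t\<in>{0..T}. norm (u t) \<le> R \<Longrightarrow>
     norm (u 0) \<le> M \<and> norm (u T - W u T) \<le> M \<and> (\<forall>t\<in>{0..T}. norm (W u t) \<le> M)"
    using curve_bound[of R] by blast
  \<comment> \<open>At norm r the lower bound of \<open>shoot_inner_ge\<close> equals T, and it
    increases from there on, so every zero lies inside radius r.\<close>
  define r where "r = (2 * a * M - \<Phi> 0 + M\<^sup>2 / T + 1) / a"
  have r0: "0 \<le> r" 
  proof -
    have "0 \<le> 2 * a * M" "0 \<le> M\<^sup>2 / T" "\<Phi> 0 \<le> 0" using a T M(1) Phi_nonpos[of 0] by auto
    then show ?thesis using a unfolding r_def by (intro divide_nonneg_pos) linarith+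
  qed
  have r1: "0 < T * (a * s - 2 * a * M + \<Phi> 0) - M\<^sup>2" if "r \<le> s" for s
  proof -
    have "T * (a * r - 2 * a * M + \<Phi> 0) - M\<^sup>2 = T" using a T by (simp add: r_def field_simps)
    moreover have "T * (a * r - 2 * a * M + \<Phi> 0) \<le> T * (a * s - 2 * a * M + \<Phi> 0)"
      using that a T by simp
    ultimately show ?thesis using T by linarith
  qed
  define B where "B = 2 * r + 2 * M"
  have "(\<exists>p. shoot u p = 0) \<and> (\<forall>p. shoot u p = 0 \<longrightarrow> norm p \<le> B \<and> norm (bdry u p) \<le> B)"
    if u: "continuous_on {0..T} u" "\<forall>t\<in>{0..T}. norm (u t) \<le> R" for u
  proof -
    note Mu = M(2)[OF u]
    have pos: "0 < shoot u p \<bullet> p" if "r \<le> norm p" for p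
      by (rule less_le_trans[OF r1[OF that] shoot_inner_ge[OF u(1)]]) (rule Mu[THEN conjunct1], rule Mu[THEN conjunct2, THEN conjunct1], rule Mu[THEN conjunct2, THEN conjunct2, rule_format])
    have "\<exists>p\<in>cball 0 r. shoot u p = 0"
      by (rule coercive_zero[OF shoot_continuous[OF u(1)] r0]) (simp add: pos)
    moreover have "norm p \<le> B \<and> norm (bdry u p) \<le> B" if p: "shoot u p = 0" for p
    proof -
      have "norm p \<le> r" using pos[of p] p by force
      moreover have "norm (bdry u p) \<le> norm (p + u 0) + norm (u T - W u T - p)"
        unfolding bdry_def using prox_norm_le norm_Pair_le order_trans by blast
      moreover have "norm (p + u 0) \<le> norm p + norm (u 0)" by (rule norm_triangle_ineq)
      moreover have "norm (u T - W u T - p) \<le> norm (u T - W u T) + norm p" by (rule norm_triangle_ineq4)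
      ultimately show ?thesis using Mu r0 M(1) by (auto simp: B_def)
    qed
    ultimately show ?thesis by blast
  qed
  moreover have "0 \<le> B" using r0 M(1) by (simp add: B_def)
  ultimately show ?thesis by blast
qed

lemma continuous_curve_bounded:
  assumes "continuous_on {0..T} u" obtains R where "\<forall>t\<in>{0..T}. norm (u t) \<le> R"
  using compact_imp_bounded[OF compact_continuous_image[OF assms compact_Icc]] by (auto simp: bounded_iff)

lemma shoot_eq_0_iff:
  assumes u: "continuous_on {0..T} u"
  shows "shoot u p = 0 \<longleftrightarrow> p = P u"
proof -
  obtain R where "\<forall>t\<in>{0..T}. norm (u t) \<le> R" by (rule continuous_curve_bounded[OF u])
  then obtain q where q: "shoot u q = 0" using shoot_zero_bound[of R] u by blast
  have uniq: "p = q" if "shoot u p = 0" for p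
    using shoot_strictly_monotone[OF u, of p q] q that by auto
  have "P u = q" unfolding P_def using q uniq by blast
  with q uniq show ?thesis by blast
qed

lemma P_bound:
  obtains B where "0 \<le> B" and "\<And>u :: real \<Rightarrow> 'a. continuous_on {0..T} u \<Longrightarrow> (\<And>t. t \<in> {0..T} \<Longrightarrow> norm (u t) \<le> R) \<Longrightarrow>
    norm (P u) \<le> B \<and> norm (X u) \<le> B"
proof -
  obtain B where B: "0 \<le> B" "\<forall>u. continuous_on {0..T} u \<and> (\<forall>t\<in>{0..T}. norm (u t) \<le> R) \<longrightarrow>
     (\<exists>p. shoot u p = 0) \<and> (\<forall>p. shoot u p = 0 \<longrightarrow> norm p \<le> B \<and> norm (bdry u p) \<le> B)"
    using shoot_zero_bound by blast
  show ?thesis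
  proof (rule that[OF B(1)])
    fix u :: "real \<Rightarrow> 'a"
    assume u: "continuous_on {0..T} u" "\<And>t. t \<in> {0..T} \<Longrightarrow> norm (u t) \<le> R"
    then have "norm (P u) \<le> B \<and> norm (bdry u (P u)) \<le> B"
      using B(2) shoot_eq_0_iff[OF u(1), of "P u"] by blast
    then show "norm (P u) \<le> B \<and> norm (X u) \<le> B"
      using norm_fst_le[of "fst (bdry u (P u))" "snd (bdry u (P u))"] by (simp add: X_def)
  qed
qed

text \<open>The parameters are bounded, and every limit of a subsequence is a zero of
  \<open>shoot u\<close>, of which there is only one.\<close>

lemma P_tendsto:
  assumes f: "\<And>n. continuous_on {0..T} (f n)" and u: "continuous_on {0..T} u"
    and lim: "uniform_limit {0..T} f u sequentially"
  shows "(\<lambda>n. P (f n)) \<longlonglongrightarrow> P u"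
proof -
  obtain R where R: "\<forall>t\<in>{0..T}. norm (u t) \<le> R" by (rule continuous_curve_bounded[OF u])
  obtain N where N: "\<And>n t. n \<ge> N \<Longrightarrow> t \<in> {0..T} \<Longrightarrow> dist (f n t) (u t) < 1"
    using lim unfolding uniform_limit_sequentially_iff by (metis zero_less_one)
  \<comment> \<open>The curves satisfy the bound \<open>R + 1\<close> only from N on.\<close>
  define g where "g n = f (n + N)" for n
  have gR: "norm (g n t) \<le> R + 1" if "t \<in> {0..T}" for n t
  proof -
    have "norm (g n t) \<le> norm (u t) + dist (g n t) (u t)"
      by (metis dist_norm norm_triangle_sub)
    moreover have "dist (g n t) (u t) < 1" using N[of "n + N" t] that by (simp add: g_def)
    ultimately show ?thesis using R that by force
  qed
  have gc: "continuous_on {0..T} (g n)" for n using f by (simp add: g_def)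
  have glim: "uniform_limit {0..T} g u sequentially"
    unfolding g_def by (rule uniform_limit_subseq[OF lim]) (simp add: strict_mono_def)
  obtain B where B: "\<And>n. norm (P (g n)) \<le> B"
    by (rule P_bound[of "R + 1"]) (use gR gc in blast)
  have "(\<lambda>n. P (g n)) \<longlonglongrightarrow> P u"
  proof (rule tendsto_if_subseq_limits_eq)
    show "bounded (range (\<lambda>n. P (g n)))" using B by (auto simp: bounded_iff)
    fix r :: "nat \<Rightarrow> nat" and L assume r: "strict_mono r" and L: "((\<lambda>n. P (g n)) \<circ> r) \<longlonglongrightarrow> L"
    have "uniform_limit {0..T} (g \<circ> r) u sequentially"
      unfolding o_def by (rule uniform_limit_subseq[OF glim r])
    then have "(\<lambda>n. shoot ((g \<circ> r) n) (P ((g \<circ> r) n))) \<longlonglongrightarrow> shoot u L"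
      using L by (intro shoot_tendsto u) (auto simp: gc o_def)
    moreover have "shoot ((g \<circ> r) n) (P ((g \<circ> r) n)) = 0" for n
      using shoot_eq_0_iff[OF gc] by simp
    ultimately have "shoot u L = 0" by (simp add: LIMSEQ_const_iff)
    then show "L = P u" using shoot_eq_0_iff[OF u] by simp
  qed
  then show ?thesis unfolding g_def by (rule LIMSEQ_offset)
qed

lemma X_tendsto:
  assumes "\<And>n. continuous_on {0..T} (f n)" and "continuous_on {0..T} u"
    and "uniform_limit {0..T} f u sequentially"
  shows "(\<lambda>n. X (f n)) \<longlonglongrightarrow> X u"
  unfolding X_def by (intro tendsto_fst bdry_tendsto P_tendsto assms)

lemma V_uniform_limit:
  assumes "\<And>n. continuous_on {0..T} (f n)" and "continuous_on {0..T} u"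
    and "uniform_limit {0..T} f u sequentially"
  shows "uniform_limit {0..T} (\<lambda>n. V (f n)) (V u) sequentially"
  unfolding V_def by (intro psi_W_uniform_limit P_tendsto assms)

lemma continuous_V: "continuous_on {0..T} u \<Longrightarrow> continuous_on {0..T} (V u)"
  unfolding V_def by (rule continuous_psi_W)

lemma U_uniform_limit:
  assumes "\<And>n. continuous_on {0..T} (f n)" and "continuous_on {0..T} u"
    and "uniform_limit {0..T} f u sequentially"
  shows "uniform_limit {0..T} (\<lambda>n. U (f n)) (U u) sequentially"
  unfolding U_def
  by (intro uniform_limit_add uniform_limit_tendsto_const uniform_limit_indefinite_integral
      X_tendsto V_uniform_limit continuous_V assms)

lemma U_0: "U u 0 = X u"
  by (simp add: U_def)

text \<open>A zero of \<open>shoot\<close> means that the integral of the velocity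
  \<open>V u\<close> equals the difference of the end points chosen by \<open>prox\<close>.\<close>

lemma bdry_P:
  assumes "continuous_on {0..T} u"
  shows "bdry u (P u) = (U u 0, U u T)"
  using shoot_eq_0_iff[OF assms, of "P u"]
  by (auto simp: U_def X_def V_def[abs_def] shoot_def algebra_simps prod_eq_iff)


section \<open>Energy and gap\<close>

text \<open>Curves are carried as initial value and velocity: \<Phi> acts on the velocity, whose
  continuity has to be maintained, and convex combinations of curves are those of the two
  data.\<close>

definition curve :: "'a \<Rightarrow> (real \<Rightarrow> 'a) \<Rightarrow> real \<Rightarrow> 'a" where
  "curve x v t = x + integral {0..t} v"

definition admissible :: "'a \<Rightarrow> (real \<Rightarrow> 'a) \<Rightarrow> bool" where
  "admissible x v \<longleftrightarrow> continuous_on {0..T} v \<and> (\<forall>t\<in>{0..T}. norm (v t) \<le> a) \<and> (x, curve x v T) \<in> D"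

text \<open>The formal Euler-Lagrange equation of this action is the system, and its natural
  boundary condition is the inclusion in the subdifferential of j.\<close>

definition energy :: "'a \<Rightarrow> (real \<Rightarrow> 'a) \<Rightarrow> real" where
  "energy x v = integral {0..T} (\<lambda>t. \<Phi> (v t)) + J (x, curve x v T)
     - integral {0..T} (\<lambda>t. F t (curve x v t))"

text \<open>The rate at which the energy, with \<open>\<Phi>\<close> and \<open>j\<close> replaced by their chords, decreases along the
  segment from the curve \<open>u\<close> to \<open>U u\<close>.\<close>

definition gap :: "'a \<Rightarrow> (real \<Rightarrow> 'a) \<Rightarrow> real" where
  "gap x v = (let u = curve x v in
     integral {0..T} (\<lambda>t. \<Phi> (v t)) + J (x, u T)
     - (integral {0..T} (\<lambda>t. \<Phi> (V u t)) + J (X u, U u T))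
     + integral {0..T} (\<lambda>t. G t (u t) \<bullet> (U u t - u t)))"

lemma curve_0 [simp]: "curve x v 0 = x"
  by (simp add: curve_def)

lemma U_eq_curve: "U u = curve (X u) (V u)"
  by (simp add: U_def curve_def fun_eq_iff)

lemma continuous_curve: "continuous_on {0..T} v \<Longrightarrow> continuous_on {0..T} (curve x v)"
  unfolding curve_def[abs_def]
  by (intro continuous_intros indefinite_integral_continuous_1 integrable_continuous_real)

lemma continuous_U: "continuous_on {0..T} u \<Longrightarrow> continuous_on {0..T} (U u)"
  unfolding U_eq_curve by (intro continuous_curve continuous_V)

lemma continuous_Phi:
  "continuous_on S v \<Longrightarrow> (\<And>t. t \<in> S \<Longrightarrow> norm (v t) \<le> a) \<Longrightarrow> continuous_on S (\<lambda>t. \<Phi> (v t))"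
  by (rule continuous_on_compose2[OF Phi_cont]) auto

lemma V_le: "norm (V u t) \<le> a"
  unfolding V_def using psi_less less_imp_le by blast

lemma continuous_Phi_V: "continuous_on {0..T} u \<Longrightarrow> continuous_on {0..T} (\<lambda>t. \<Phi> (V u t))"
  by (intro continuous_Phi continuous_V V_le)

lemma curve_has_vector_derivative:
  assumes "continuous_on {0..T} v" "t \<in> {0..T}"
  shows "(curve x v has_vector_derivative v t) (at t within {0..T})"
  unfolding curve_def[abs_def]
  using has_vector_derivative_add[OF has_vector_derivative_const integral_has_vector_derivative[OF assms]]
  by simp

lemma W_has_vector_derivative:
  assumes "continuous_on {0..T} u" "t \<in> {0..T}"
  shows "(W u has_vector_derivative - G t (u t)) (at t within {0..T})"
  unfolding W_def[abs_def]
  by (intro has_vector_derivative_minus integral_has_vector_derivative[OF continuous_G] assms)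

lemma curve_norm_le:
  assumes v: "continuous_on {0..T} v" "\<And>t. t \<in> {0..T} \<Longrightarrow> norm (v t) \<le> a" and t: "t \<in> {0..T}"
  shows "norm (curve x v t - x) \<le> a * T"
proof -
  have "norm (curve x v t - x) \<le> a * (t - 0)"
    unfolding curve_def using t
    by (simp, intro integral_bound[of 0 t v a, simplified] v continuous_on_subset[OF v(1)]) auto
  also have "\<dots> \<le> a * T" using t a by simp
  finally show ?thesis .
qed

lemma curve_lipschitz:
  assumes v: "continuous_on {0..T} v" "\<And>t. t \<in> {0..T} \<Longrightarrow> norm (v t) \<le> a"
    and st: "s \<in> {0..T}" "t \<in> {0..T}"
  shows "norm (curve x v s - curve x v t) \<le> a * \<bar>s - t\<bar>"
proof -
  have le: "norm (curve x v s - curve x v t) \<le> a * (s - t)" if "t \<le> s" "0 \<le> t" "s \<le> T" for s t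
  proof -
    have "integral {0..t} v + integral {t..s} v = integral {0..s} v"
      using that
      by (intro Henstock_Kurzweil_Integration.integral_combine integrable_continuous_real
          continuous_on_subset[OF v(1)]) auto
    then have "curve x v s - curve x v t = integral {t..s} v"
      by (simp add: curve_def algebra_simps)
    also have "norm \<dots> \<le> a * (s - t)"
      using that by (intro integral_bound v continuous_on_subset[OF v(1)]) auto
    finally show ?thesis .
  qed
  show ?thesis
    using le[of s t] le[of t s] st by (cases "t \<le> s") (auto simp: norm_minus_commute)
qed

lemma admissible_XV:
  assumes "continuous_on {0..T} u" shows "admissible (X u) (V u)"
proof -
  have "(X u, curve (X u) (V u) T) = bdry u (P u)"
    by (simp add: bdry_P[OF assms] U_0 U_eq_curve[symmetric])
  then show ?thesis
    using prox_in by (simp add: admissible_def continuous_V[OF assms] V_le bdry_def)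
qed

lemma curve_step:
  assumes v: "continuous_on {0..T} v" "continuous_on {0..T} v'" and t: "t \<in> {0..T}"
  shows "curve (x + s *\<^sub>R (x' - x)) (\<lambda>t. v t + s *\<^sub>R (v' t - v t)) t
      = curve x v t + s *\<^sub>R (curve x' v' t - curve x v t)"
proof -
  have i: "v integrable_on {0..t}" "v' integrable_on {0..t}"
    using t by (auto intro!: integrable_continuous_real intro: continuous_on_subset[OF v(1)] continuous_on_subset[OF v(2)])
  have "integral {0..t} (\<lambda>t. v t + s *\<^sub>R (v' t - v t)) = integral {0..t} v + s *\<^sub>R (integral {0..t} v' - integral {0..t} v)"
    using i by (simp add: integral_add integral_diff integrable_diff integrable_cmul)
  then show ?thesis by (simp add: curve_def algebra_simps)
qed

lemma admissible_step:
  assumes 1: "admissible x v" and 2: "admissible x' v'" and s: "0 \<le> s" "s \<le> 1"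
  shows "admissible (x + s *\<^sub>R (x' - x)) (\<lambda>t. v t + s *\<^sub>R (v' t - v t))"
proof -
  have v: "continuous_on {0..T} v" "continuous_on {0..T} v'" using 1 2 by (auto simp: admissible_def)
  have "norm (v t + s *\<^sub>R (v' t - v t)) \<le> a" if "t \<in> {0..T}" for t
  proof -
    have "v t \<in> cball 0 a" "v' t \<in> cball 0 a" using 1 2 that by (auto simp: admissible_def)
    then have "(1 - s) *\<^sub>R v t + s *\<^sub>R v' t \<in> cball 0 a"
      using s convexD_alt[OF convex_cball] by blast
    then show ?thesis unfolding convex_combination_eq by simp
  qed
  moreover have "(x, curve x v T) + s *\<^sub>R ((x', curve x' v' T) - (x, curve x v T)) \<in> D"
    using D_convex[of "(x, curve x v T)" "(x', curve x' v' T)" s] 1 2 s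
    unfolding convex_combination_eq by (simp add: admissible_def)
  ultimately show ?thesis
    using T unfolding admissible_def curve_step[OF v, of T, simplified]
    by (auto intro!: continuous_intros v simp: curve_step[OF v])
qed

text \<open>Integration by parts: \<open>P u + W u t\<close> is the momentum of \<open>U u\<close>,
  a subgradient of \<Phi> at \<open>V u t\<close>, and its derivative is
  \<open>- G t (u t)\<close>.\<close>

lemma boundary_product_integral:
  assumes v: "continuous_on {0..T} v" and u: "u = curve x v"
  shows "integral {0..T} (\<lambda>t. (P u + W u t) \<bullet> (v t - V u t)) - integral {0..T} (\<lambda>t. G t (u t) \<bullet> (u t - U u t))
      = (P u + W u T) \<bullet> (u T - U u T) - P u \<bullet> (x - X u)"
proof -
  have cu: "continuous_on {0..T} u" unfolding u by (rule continuous_curve[OF v])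
  define h where "h t = (P u + W u t) \<bullet> (u t - U u t)" for t
  have "((\<lambda>t. (P u + W u t) \<bullet> (v t - V u t) + (0 + - G t (u t)) \<bullet> (u t - U u t)) has_integral (h T - h 0)) {0..T}"
  proof (rule fundamental_theorem_of_calculus)
    fix t assume t: "t \<in> {0..T}"
    have 1: "((\<lambda>t. P u + W u t) has_vector_derivative 0 + - G t (u t)) (at t within {0..T})"
      by (intro has_vector_derivative_add has_vector_derivative_const W_has_vector_derivative cu t)
    have 2: "((\<lambda>t. u t - U u t) has_vector_derivative v t - V u t) (at t within {0..T})"
      unfolding U_eq_curve
      by (intro has_vector_derivative_diff curve_has_vector_derivative continuous_V cu t)
        (unfold u, intro curve_has_vector_derivative v t)
    show "(h has_vector_derivative (P u + W u t) \<bullet> (v t - V u t) + (0 + - G t (u t)) \<bullet> (u t - U u t))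
        (at t within {0..T})"
      unfolding h_def
      by (rule bounded_bilinear.has_vector_derivative[OF bounded_bilinear_inner 1 2])
  qed (use T in simp)
  then have "integral {0..T} (\<lambda>t. (P u + W u t) \<bullet> (v t - V u t) - G t (u t) \<bullet> (u t - U u t)) = h T - h 0"
    by (simp add: integral_unique)
  moreover have "integral {0..T} (\<lambda>t. (P u + W u t) \<bullet> (v t - V u t) - G t (u t) \<bullet> (u t - U u t))
      = integral {0..T} (\<lambda>t. (P u + W u t) \<bullet> (v t - V u t)) - integral {0..T} (\<lambda>t. G t (u t) \<bullet> (u t - U u t))"
    by (intro integral_diff integrable_continuous_real continuous_intros continuous_W continuous_V
        continuous_G continuous_U cu v)
  moreover have "h 0 = P u \<bullet> (x - X u)"
    by (simp add: h_def U_0 u W_def)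
  ultimately show ?thesis by (simp add: h_def)
qed

text \<open>The subgradient inequality of \<open>prox\<close> and the integration by parts contain
  the same products of momentum and displacement at the end points, which cancel. What remains is
  the Bregman distance of \<Phi> between the velocities and the squares due to the penalty.\<close>

lemma gap_ge:
  assumes adm: "admissible x v" and u: "u = curve x v"
  shows "integral {0..T} (\<lambda>t. \<Phi> (v t) - \<Phi> (V u t) - (P u + W u t) \<bullet> (v t - V u t))
      + (norm (x - X u))\<^sup>2 + (norm (u T - U u T))\<^sup>2 \<le> gap x v"
proof -
  have v: "continuous_on {0..T} v" "\<And>t. t \<in> {0..T} \<Longrightarrow> norm (v t) \<le> a" and D: "(x, u T) \<in> D"
    using adm u by (auto simp: admissible_def)
  have cu: "continuous_on {0..T} u" unfolding u by (rule continuous_curve[OF v(1)])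
  have ux: "u 0 = x" by (simp add: u)
  have pr: "prox (P u + x, (u T - W u T) - P u) = (X u, U u T)"
    using bdry_P[OF cu] by (simp add: bdry_def U_0 ux)
  have "J (X u, U u T) + ((P u + x, (u T - W u T) - P u) - (X u, U u T)) \<bullet> ((x, u T) - (X u, U u T)) \<le> J (x, u T)"
    using prox_subgrad[OF D, of "(P u + x, (u T - W u T) - P u)"] unfolding pr .
  then have j: "P u \<bullet> (x - X u) + (norm (x - X u))\<^sup>2 - (P u + W u T) \<bullet> (u T - U u T) + (norm (u T - U u T))\<^sup>2
      \<le> J (x, u T) - J (X u, U u T)"
    by (simp add: power2_norm_eq_inner algebra_simps inner_commute)
  have "integral {0..T} (\<lambda>t. \<Phi> (v t) - \<Phi> (V u t) - (P u + W u t) \<bullet> (v t - V u t))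
      = integral {0..T} (\<lambda>t. \<Phi> (v t)) - integral {0..T} (\<lambda>t. \<Phi> (V u t))
        - integral {0..T} (\<lambda>t. (P u + W u t) \<bullet> (v t - V u t))"
    by (subst integral_diff integral_diff,
        auto intro!: integrable_continuous_real continuous_intros continuous_Phi v continuous_Phi_V
          continuous_W continuous_V cu)+
  moreover have "integral {0..T} (\<lambda>t. G t (u t) \<bullet> (U u t - u t)) = - integral {0..T} (\<lambda>t. G t (u t) \<bullet> (u t - U u t))"
    unfolding integral_neg[symmetric] by (simp add: inner_diff_right)
  ultimately show ?thesis
    using j boundary_product_integral[OF v(1) u] by (simp add: gap_def u[symmetric] Let_def)
qed

section \<open>Uniform positivity of the gap\<close>

lemma bregman_nonneg:
  "norm y \<le> a \<Longrightarrow> 0 \<le> \<Phi> y - \<Phi> (\<psi> w) - w \<bullet> (y - \<psi> w)"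
  using Phi_subgrad_le[of y w] by simp

text \<open>The velocity bound confines a curve to radius \<open>R + a * T\<close>, so bounding the
  initial value bounds all that is computed from the curve.\<close>

lemma curve_data_bound:
  obtains B where "0 \<le> B" "\<And>x v t. \<lbrakk>admissible x v; norm x \<le> R; t \<in> {0..T}\<rbrakk> \<Longrightarrow>
      norm (curve x v t) \<le> B \<and> norm (U (curve x v) t) \<le> B \<and> norm (P (curve x v) + W (curve x v) t) \<le> B"
proof -
  obtain B where B: "0 \<le> B" "\<And>u :: real \<Rightarrow> 'a. continuous_on {0..T} u \<Longrightarrow>
      (\<And>t. t \<in> {0..T} \<Longrightarrow> norm (u t) \<le> R + a * T) \<Longrightarrow> norm (P u) \<le> B \<and> norm (X u) \<le> B"
    using P_bound by blast
  obtain M where M: "0 \<le> M" "\<And>u. continuous_on {0..T} u \<Longrightarrow> \<forall>t\<in>{0..T}. norm (u t) \<le> R + a * T \<Longrightarrow>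
     norm (u 0) \<le> M \<and> norm (u T - W u T) \<le> M \<and> (\<forall>t\<in>{0..T}. norm (W u t) \<le> M)"
    using curve_bound[of "R + a * T"] by blast
  define C where "C = \<bar>R\<bar> + a * T + B + M"
  show ?thesis
  proof (rule that[of C])
    show "0 \<le> C" using a T B(1) M(1) by (simp add: C_def)
    fix x v t assume adm: "admissible x v" and x: "norm x \<le> R" and t: "t \<in> {0..T}"
    have v: "continuous_on {0..T} v" "\<And>t. t \<in> {0..T} \<Longrightarrow> norm (v t) \<le> a"
      using adm by (auto simp: admissible_def)
    define u where "u = curve x v"
    have cu: "continuous_on {0..T} u" unfolding u_def by (rule continuous_curve[OF v(1)])
    have uR: "norm (u s) \<le> R + a * T" if "s \<in> {0..T}" for s
      using curve_norm_le[OF v that, of x] norm_triangle_sub[of "u s" x] x by (simp add: u_def)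
    have 1: "norm (P u) \<le> B" "norm (X u) \<le> B" using B(2)[OF cu uR] by auto
    have 2: "norm (W u t) \<le> M" using M(2)[OF cu] uR t by blast
    have 3: "norm (U u t) \<le> norm (X u) + a * T"
      using curve_norm_le[OF continuous_V[OF cu] V_le t, of "X u"] norm_triangle_sub[of "U u t" "X u"]
      by (simp add: U_eq_curve)
    have 4: "norm (P u + W u t) \<le> norm (P u) + norm (W u t)" by (rule norm_triangle_ineq)
    have "norm (u t) \<le> C \<and> norm (U u t) \<le> C \<and> norm (P u + W u t) \<le> C"
      using uR[OF t] 1 2 3 4 a T B(1) M(1) mult_pos_pos[OF a T] unfolding C_def by linarith
    then show "norm (curve x v t) \<le> C \<and> norm (U (curve x v) t) \<le> C \<and> norm (P (curve x v) + W (curve x v) t) \<le> C"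
      by (simp add: u_def)
  qed
qed

text \<open>The Bregman distance in \<open>gap_ge\<close> vanishes only for equal velocities.
  \<open>compact_modulus\<close>, applied to pairs of a bounded momentum and a velocity, makes this
  quantitative up to an additive constant, and integration carries it over to the curves.\<close>

lemma gap_controls_distance:
  assumes "0 < \<delta>"
  obtains C where "0 \<le> C" "\<And>x v t. \<lbrakk>admissible x v; norm x \<le> R; t \<in> {0..T}\<rbrakk> \<Longrightarrow>
      norm (curve x v t - U (curve x v) t) \<le> \<delta> + C * gap x v"
proof -
  obtain B where B: "0 \<le> B" "\<And>x v t. \<lbrakk>admissible x v; norm x \<le> R; t \<in> {0..T}\<rbrakk> \<Longrightarrow>
      norm (curve x v t) \<le> B \<and> norm (U (curve x v) t) \<le> B \<and> norm (P (curve x v) + W (curve x v) t) \<le> B"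
    using curve_data_bound by metis
  define d where "d p = \<Phi> (snd p) - \<Phi> (\<psi> (fst p)) - fst p \<bullet> (snd p - \<psi> (fst p))" for p
  define e where "e p = norm (snd p - \<psi> (fst p))" for p
  \<comment> \<open>Half of \<delta> is spent on the velocities, which gives \<delta> / (2 T) at
    each time; the other half is kept for the initial values.\<close>
  have "\<exists>C\<ge>0. \<forall>p \<in> cball 0 B \<times> cball 0 a. e p \<le> \<delta> / (2 * T) + C * d p"
  proof (rule compact_modulus)
    show "compact (cball (0::'a) B \<times> cball (0::'a) a)" by (intro compact_Times compact_cball)
    show "continuous_on (cball 0 B \<times> cball 0 a) d"
      unfolding d_def
      by (intro continuous_intros continuous_Phi continuous_psi continuous_on_fst continuous_on_snd
          continuous_on_id) (auto simp: less_imp_le psi_less)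
    show "continuous_on (cball 0 B \<times> cball 0 a) e"
      unfolding e_def by (intro continuous_intros continuous_psi)
    fix p assume p: "p \<in> cball (0::'a) B \<times> cball (0::'a) a"
    show "0 \<le> d p" unfolding d_def using p by (intro bregman_nonneg) auto
    show "e p \<le> 0" if "d p = 0"
      using Phi_subgrad[of "snd p" "fst p"] p that by (force simp: d_def e_def)
  qed (use \<open>0 < \<delta>\<close> T in simp)
  then obtain C where C: "0 \<le> C" "\<And>w y. norm w \<le> B \<Longrightarrow> norm y \<le> a \<Longrightarrow>
      norm (y - \<psi> w) \<le> \<delta> / (2 * T) + C * (\<Phi> y - \<Phi> (\<psi> w) - w \<bullet> (y - \<psi> w))"
    by (force simp: d_def e_def)
  show ?thesis
  proof (rule that[of "2 / \<delta> + C"])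
    show "0 \<le> 2 / \<delta> + C" using C(1) \<open>0 < \<delta>\<close> by simp
    fix x v t assume adm: "admissible x v" and x: "norm x \<le> R" and t: "t \<in> {0..T}"
    have v: "continuous_on {0..T} v" "\<And>t. t \<in> {0..T} \<Longrightarrow> norm (v t) \<le> a"
      using adm by (auto simp: admissible_def)
    define u where "u = curve x v"
    have cu: "continuous_on {0..T} u" unfolding u_def by (rule continuous_curve[OF v(1)])
    define b where "b t = \<Phi> (v t) - \<Phi> (V u t) - (P u + W u t) \<bullet> (v t - V u t)" for t
    have cb: "continuous_on {0..T} b"
      unfolding b_def by (intro continuous_intros continuous_Phi v continuous_Phi_V continuous_W continuous_V cu)
    have b0: "0 \<le> b t" if "t \<in> {0..T}" for t
      using bregman_nonneg[OF v(2)[OF that]] by (simp add: b_def V_def)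
    have ib0: "0 \<le> integral {0..T} b"
      by (rule integral_nonneg[OF integrable_continuous_real[OF cb] b0])
    have g: "integral {0..T} b + (norm (x - X u))\<^sup>2 + (norm (u T - U u T))\<^sup>2 \<le> gap x v"
      using gap_ge[OF adm u_def] by (simp add: b_def[abs_def])
    have g1: "integral {0..T} b \<le> gap x v" and g2: "(norm (x - X u))\<^sup>2 \<le> gap x v"
      using g ib0 zero_le_power2[of "norm (x - X u)"] zero_le_power2[of "norm (u T - U u T)"] by linarith+
    \<comment> \<open>Either the distance is at most \<delta> / 2, or it is at most 2 / \<delta>
      times its square, which the gap bounds.\<close>
    have x1: "norm (x - X u) \<le> \<delta> / 2 + 2 / \<delta> * gap x v"
    proof (cases "norm (x - X u) \<le> \<delta> / 2")
      case True
      moreover have "0 \<le> 2 / \<delta> * gap x v" using g1 ib0 \<open>0 < \<delta>\<close> by simp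
      ultimately show ?thesis by linarith
    next
      case False
      then have "\<delta> / 2 * norm (x - X u) \<le> norm (x - X u) * norm (x - X u)"
        by (intro mult_right_mono) auto
      also have "\<dots> \<le> gap x v" using g2 by (simp add: power2_eq_square)
      finally have "norm (x - X u) \<le> 2 / \<delta> * gap x v" using \<open>0 < \<delta>\<close> by (simp add: field_simps)
      then show ?thesis using \<open>0 < \<delta>\<close> by linarith
    qed
    have cVt: "continuous_on {0..t} (V u)" "continuous_on {0..t} v"
      using t by (auto intro: continuous_on_subset[OF continuous_V[OF cu]] continuous_on_subset[OF v(1)])
    have "norm (integral {0..t} v - integral {0..t} (V u)) = norm (integral {0..t} (\<lambda>s. v s - V u s))"
      by (subst integral_diff) (auto intro: integrable_continuous_real cVt)
    also have "\<dots> \<le> integral {0..t} (\<lambda>s. \<delta> / (2 * T) + C * b s)"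
    proof (rule integral_norm_bound_integral)
      show "(\<lambda>s. v s - V u s) integrable_on {0..t}"
        by (intro integrable_continuous_real continuous_intros cVt)
      show "(\<lambda>s. \<delta> / (2 * T) + C * b s) integrable_on {0..t}"
        using t by (intro integrable_continuous_real continuous_intros continuous_on_subset[OF cb]) auto
      fix s assume "s \<in> {0..t}"
      then have s: "s \<in> {0..T}" using t by auto
      show "norm (v s - V u s) \<le> \<delta> / (2 * T) + C * b s"
        unfolding b_def V_def using B(2)[OF adm x s] v(2)[OF s] by (intro C(2)) (auto simp: u_def)
    qed
    also have "\<dots> \<le> integral {0..T} (\<lambda>s. \<delta> / (2 * T) + C * b s)"
    proof (rule integral_subset_le)
      show "(\<lambda>s. \<delta> / (2 * T) + C * b s) integrable_on {0..t}"
        using t by (intro integrable_continuous_real continuous_intros continuous_on_subset[OF cb]) auto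
      show "(\<lambda>s. \<delta> / (2 * T) + C * b s) integrable_on {0..T}"
        by (intro integrable_continuous_real continuous_intros cb)
      show "\<forall>s\<in>{0..T}. 0 \<le> \<delta> / (2 * T) + C * b s"
        using b0 C(1) \<open>0 < \<delta>\<close> T by simp
    qed (use t in auto)
    also have "\<dots> = \<delta> / 2 + C * integral {0..T} b"
      using T by (subst integral_add) (auto intro!: integrable_continuous_real continuous_intros cb)
    also have "\<dots> \<le> \<delta> / 2 + C * gap x v"
      using g1 C(1) by (intro add_left_mono mult_left_mono) auto
    finally have 1: "norm (integral {0..t} v - integral {0..t} (V u)) \<le> \<delta> / 2 + C * gap x v" .
    have "u t - U u t = (x - X u) + (integral {0..t} v - integral {0..t} (V u))"
      by (simp add: u_def U_def curve_def)
    then have "norm (u t - U u t) \<le> norm (x - X u) + norm (integral {0..t} v - integral {0..t} (V u))"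
      by (metis norm_triangle_ineq)
    with 1 x1 show "norm (curve x v t - U (curve x v) t) \<le> \<delta> + (2 / \<delta> + C) * gap x v"
      by (simp add: u_def algebra_simps)
  qed
qed


lemma gap_nonneg: "admissible x v \<Longrightarrow> 0 \<le> gap x v"
proof -
  assume adm: "admissible x v"
  have v: "continuous_on {0..T} v" "\<And>t. t \<in> {0..T} \<Longrightarrow> norm (v t) \<le> a"
    using adm by (auto simp: admissible_def)
  define u where "u = curve x v"
  have cu: "continuous_on {0..T} u" unfolding u_def by (rule continuous_curve[OF v(1)])
  have "0 \<le> integral {0..T} (\<lambda>t. \<Phi> (v t) - \<Phi> (V u t) - (P u + W u t) \<bullet> (v t - V u t))"
  proof (rule integral_nonneg)
    show "(\<lambda>t. \<Phi> (v t) - \<Phi> (V u t) - (P u + W u t) \<bullet> (v t - V u t)) integrable_on {0..T}"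
      by (intro integrable_continuous_real continuous_intros continuous_Phi v continuous_Phi_V
          continuous_W continuous_V cu)
    show "0 \<le> \<Phi> (v t) - \<Phi> (V u t) - (P u + W u t) \<bullet> (v t - V u t)" if "t \<in> {0..T}" for t
      unfolding V_def by (rule bregman_nonneg) (rule v(2)[OF that])
  qed
  moreover have "0 \<le> (norm (x - X u))\<^sup>2" "0 \<le> (norm (u T - U u T))\<^sup>2" by simp_all
  ultimately show ?thesis using gap_ge[OF adm u_def] by linarith
qed

text \<open>Curves whose gap tends to 0 have, by Arzela-Ascoli, a uniform limit point, which is a fixed point
  of \<open>U\<close>.\<close>

lemma gap_bounded_below:
  assumes nofix: "\<nexists>u. continuous_on {0..T} u \<and> (\<forall>t\<in>{0..T}. u t = U u t)"
  obtains m where "0 < m" "\<And>x v. admissible x v \<Longrightarrow> norm x \<le> R \<Longrightarrow> m \<le> gap x v"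
proof (rule ccontr)
  assume neg: "\<not> thesis"
  have "\<exists>x v. admissible x v \<and> norm x \<le> R \<and> gap x v < 1 / Suc n" for n
    using neg that[of "1 / Suc n"] by (force simp: not_le)
  then obtain x v where xv: "\<And>n. admissible (x n) (v n)" "\<And>n. norm (x n) \<le> R"
      "\<And>n. gap (x n) (v n) < 1 / Suc n"
    by metis
  define u where "u n = curve (x n) (v n)" for n
  have v: "continuous_on {0..T} (v n)" "t \<in> {0..T} \<Longrightarrow> norm (v n t) \<le> a" for n t
    using xv(1)[of n] by (auto simp: admissible_def)
  have cu: "continuous_on {0..T} (u n)" for n unfolding u_def by (rule continuous_curve[OF v(1)])
  have bdd: "norm (u n t) \<le> R + a * T" if "t \<in> {0..T}" for n t
    using curve_norm_le[OF v(1)[of n] v(2)[where n = n] that, of "x n"] norm_triangle_sub[of "u n t" "x n"] xv(2)[of n]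
    by (simp add: u_def)
  have lip: "norm (u n s - u n t) \<le> a * \<bar>s - t\<bar>" if st: "s \<in> {0..T}" "t \<in> {0..T}" for n s t
    unfolding u_def by (rule curve_lipschitz[OF v(1)[of n] v(2)[where n = n] st])
  obtain g k where g: "continuous_on {0..T} g" and k: "strict_mono (k :: nat \<Rightarrow> nat)"
    and conv: "\<And>e. 0 < e \<Longrightarrow> \<exists>N. \<forall>n t. n \<ge> N \<and> t \<in> {0..T} \<longrightarrow> norm (u (k n) t - g t) < e"
  proof (rule Arzela_Ascoli[of "{0..T}" u "R + a * T"])
    fix t e :: real assume t: "t \<in> {0..T}" and e: "0 < e"
    show "\<exists>d>0. \<forall>n s. s \<in> {0..T} \<and> norm (t - s) < d \<longrightarrow> norm (u n t - u n s) < e"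
    proof (intro exI[of _ "e / a"] conjI allI impI)
      show "0 < e / a" using e a by simp
      fix n s assume s: "s \<in> {0..T} \<and> norm (t - s) < e / a"
      then have "a * \<bar>t - s\<bar> < e" using a by (simp add: field_simps)
      then show "norm (u n t - u n s) < e" using lip[OF t, of s n] s by linarith
    qed
  qed (use bdd in auto)
  define f where "f n = u (k n)" for n
  have cf: "continuous_on {0..T} (f n)" for n by (simp add: f_def cu)
  have lim: "uniform_limit {0..T} f g sequentially"
    unfolding uniform_limit_sequentially_iff f_def dist_norm using conv by meson
  have limU: "uniform_limit {0..T} (\<lambda>n. U (f n)) (U g) sequentially"
    by (rule U_uniform_limit[OF cf g lim])
  have gap0: "(\<lambda>n. gap (x (k n)) (v (k n))) \<longlonglongrightarrow> 0"
  proof (rule tendsto_sandwich[of "\<lambda>n. 0" _ _ "\<lambda>n. 1 / Suc (k n)"])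
    show "(\<lambda>n. 1 / real (Suc (k n))) \<longlonglongrightarrow> 0"
      using LIMSEQ_subseq_LIMSEQ[OF LIMSEQ_inverse_real_of_nat k] by (simp add: inverse_eq_divide o_def)
  qed (use gap_nonneg xv(1) xv(3) in \<open>auto intro!: always_eventually less_imp_le\<close>)
  \<comment> \<open>The velocities \<open>v (k n)\<close> need not converge, so the gap itself
    cannot be passed to the limit. The distance estimate can, since apart from the gaps, which tend
    to 0, it involves only the curves.\<close>
  have "g t = U g t" if t: "t \<in> {0..T}" for t
  proof -
    have "norm (g t - U g t) \<le> 0 + e" if "0 < e" for e
    proof -
      obtain C where C: "0 \<le> C" "\<And>x v t. \<lbrakk>admissible x v; norm x \<le> R; t \<in> {0..T}\<rbrakk> \<Longrightarrow>
          norm (curve x v t - U (curve x v) t) \<le> e + C * gap x v"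
        using gap_controls_distance[OF \<open>0 < e\<close>, of R] by metis
      have "(\<lambda>n. norm (f n t - U (f n) t)) \<longlonglongrightarrow> norm (g t - U g t)"
        by (intro tendsto_intros tendsto_uniform_limitI[OF lim t] tendsto_uniform_limitI[OF limU t])
      moreover have "(\<lambda>n. e + C * gap (x (k n)) (v (k n))) \<longlonglongrightarrow> e + C * 0"
        by (intro tendsto_intros gap0)
      ultimately have "norm (g t - U g t) \<le> e + C * 0"
        by (rule LIMSEQ_le) (auto simp: f_def u_def intro!: C(2) xv t)
      then show ?thesis by simp
    qed
    then have "norm (g t - U g t) \<le> 0" by (rule field_le_epsilon)
    then show ?thesis by simp
  qed
  with nofix g show False by blast
qed

text \<open>The terms with \<Phi> and j are bounded by their chords without error. Only F is
  expanded, and G is uniformly continuous on a compact set containing all curves involved, so one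
  \<theta> serves them all.\<close>

lemma energy_step_le:
  assumes "0 < e"
  obtains \<theta> where "0 < \<theta>" "\<theta> \<le> 1" "\<And>x v s. \<lbrakk>admissible x v; norm x \<le> R; 0 \<le> s; s \<le> \<theta>\<rbrakk> \<Longrightarrow>
      energy (x + s *\<^sub>R (X (curve x v) - x)) (\<lambda>t. v t + s *\<^sub>R (V (curve x v) t - v t))
        \<le> energy x v - s * (gap x v - e)"
proof -
  obtain B where B: "0 \<le> B" "\<And>x v t. \<lbrakk>admissible x v; norm x \<le> R; t \<in> {0..T}\<rbrakk> \<Longrightarrow>
      norm (curve x v t) \<le> B \<and> norm (U (curve x v) t) \<le> B \<and> norm (P (curve x v) + W (curve x v) t) \<le> B"
    using curve_data_bound by metis
  define K where "K = {0..T} \<times> cball (0::'a) B"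
  \<comment> \<open>Here 2 B bounds |U u - u| and T is the length of the interval, so the total
    error is at most s e. The added 1 keeps the denominator positive when B = 0.\<close>
  define e' where "e' = e / (T * (2 * B + 1))"
  have e': "0 < e'" using \<open>0 < e\<close> T B(1) by (simp add: e'_def)
  have "uniformly_continuous_on K (\<lambda>(t, x). G t x)"
    by (intro compact_uniformly_continuous continuous_on_subset[OF G_cont])
      (auto simp: K_def intro: compact_Times)
  then obtain d where d: "0 < d" "\<And>p q. p \<in> K \<Longrightarrow> q \<in> K \<Longrightarrow> dist q p < d \<Longrightarrow>
      dist ((\<lambda>(t, x). G t x) q) ((\<lambda>(t, x). G t x) p) < e'"
    using e' unfolding uniformly_continuous_on_def by meson
  \<comment> \<open>The displacement then stays below the modulus d of uniform continuity, and the
    minimum with 1 keeps the step a convex combination.\<close>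
  define \<theta> where "\<theta> = min 1 (d / (2 * (2 * B + 1)))"
  show ?thesis
  proof (rule that[of \<theta>])
    show "0 < \<theta>" "\<theta> \<le> 1" using d(1) B(1) by (auto simp: \<theta>_def)
    fix x v s assume adm: "admissible x v" and x: "norm x \<le> R" and s: "0 \<le> s" "s \<le> \<theta>"
    have s1: "s \<le> 1" using s by (simp add: \<theta>_def)
    have v: "continuous_on {0..T} v" "\<And>t. t \<in> {0..T} \<Longrightarrow> norm (v t) \<le> a" and D: "(x, curve x v T) \<in> D"
      using adm by (auto simp: admissible_def)
    define u where "u = curve x v"
    have cu: "continuous_on {0..T} u" unfolding u_def by (rule continuous_curve[OF v(1)])
    define y w where "y = x + s *\<^sub>R (X u - x)" and "w t = v t + s *\<^sub>R (V u t - v t)" for t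
    note admU = admissible_XV[OF cu]
    have admw: "admissible y w"
      unfolding y_def w_def[abs_def] by (rule admissible_step[OF adm admU s(1) s1])
    have cw: "continuous_on {0..T} w" "\<And>t. t \<in> {0..T} \<Longrightarrow> norm (w t) \<le> a"
      using admw by (auto simp: admissible_def)
    have yw: "curve y w t = u t + s *\<^sub>R (U u t - u t)" if "t \<in> {0..T}" for t
      unfolding y_def w_def[abs_def] u_def U_eq_curve
      by (rule curve_step) (use that v(1) continuous_V[OF cu] in \<open>auto simp: u_def\<close>)
    have c: "continuous_on {0..T} (\<lambda>t. \<Phi> (v t))" "continuous_on {0..T} (\<lambda>t. \<Phi> (V u t))"
        "continuous_on {0..T} (\<lambda>t. \<Phi> (w t))"
        "continuous_on {0..T} (\<lambda>t. F t (u t))" "continuous_on {0..T} (\<lambda>t. F t (curve y w t))"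
        "continuous_on {0..T} (\<lambda>t. G t (u t) \<bullet> (U u t - u t))"
      by (intro continuous_intros continuous_Phi continuous_Phi_V continuous_F continuous_G
          continuous_U continuous_curve v cw cu; assumption)+
    note int = c[THEN integrable_continuous_real]
    have "integral {0..T} (\<lambda>t. \<Phi> (w t)) \<le> integral {0..T} (\<lambda>t. (1 - s) * \<Phi> (v t) + s * \<Phi> (V u t))"
    proof (intro integral_le integrable_continuous_real continuous_intros c)
      fix t assume "t \<in> {0..T}"
      then show "\<Phi> (w t) \<le> (1 - s) * \<Phi> (v t) + s * \<Phi> (V u t)"
        using Phi_convex[of "v t" "V u t" s] v(2) V_le s(1) s1 unfolding convex_combination_eq w_def by auto
    qed
    also have "\<dots> = (1 - s) * integral {0..T} (\<lambda>t. \<Phi> (v t)) + s * integral {0..T} (\<lambda>t. \<Phi> (V u t))"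
      by (subst integral_add) (auto intro!: integrable_continuous_real continuous_intros c)
    finally have 1: "integral {0..T} (\<lambda>t. \<Phi> (w t))
        \<le> (1 - s) * integral {0..T} (\<lambda>t. \<Phi> (v t)) + s * integral {0..T} (\<lambda>t. \<Phi> (V u t))" .
    have "(1 - s) *\<^sub>R (x, u T) + s *\<^sub>R (X u, U u T) = (y, u T + s *\<^sub>R (U u T - u T))"
      unfolding convex_combination_eq by (simp add: y_def)
    also have "\<dots> = (y, curve y w T)" using yw[of T] T by simp
    finally have "(1 - s) *\<^sub>R (x, u T) + s *\<^sub>R (X u, U u T) = (y, curve y w T)" .
    then have 2: "J (y, curve y w T) \<le> (1 - s) * J (x, u T) + s * J (X u, U u T)"
      using J_convex[of "(x, u T)" "(X u, U u T)" s] D admU s(1) s1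
      by (simp add: admissible_def u_def U_eq_curve[symmetric])
    have pw: "F t (u t) + s * (G t (u t) \<bullet> (U u t - u t)) - s * (e / T) \<le> F t (curve y w t)"
      if t: "t \<in> {0..T}" for t
    proof -
      define h where "h = U u t - u t"
      have nB: "norm (u t) \<le> B" "norm (U u t) \<le> B" using B(2)[OF adm x t] by (auto simp: u_def)
      have nh: "norm h \<le> 2 * B" using norm_triangle_ineq4[of "U u t" "u t"] nB by (simp add: h_def)
      have "F t (u t) + G t (u t) \<bullet> (s *\<^sub>R h) - e' * norm (s *\<^sub>R h) \<le> F t (u t + s *\<^sub>R h)"
      proof (rule gradient_increment_bound[OF F_grad[OF t]])
        fix r :: real assume r: "r \<in> {0..1}"
        have rs: "0 \<le> r * s" "r * s \<le> \<theta>" "r * s \<le> 1"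
          using r s s1 mult_mono[of r 1 s \<theta>] mult_mono[of r 1 s 1] by auto
        have "(1 - r * s) *\<^sub>R u t + (r * s) *\<^sub>R U u t \<in> cball 0 B"
          by (rule convexD_alt[OF convex_cball]) (use nB rs in auto)
        then have in_B: "u t + (r * s) *\<^sub>R h \<in> cball 0 B" unfolding convex_combination_eq h_def .
        have "norm ((r * s) *\<^sub>R h) \<le> \<theta> * (2 * B)"
          using rs nh B(1) by (auto intro!: mult_mono)
        also have "\<dots> \<le> d / (2 * (2 * B + 1)) * (2 * B)"
          using B(1) by (intro mult_right_mono) (auto simp: \<theta>_def)
        also have "\<dots> < d"
          using B(1) d(1) by (simp add: field_simps add_pos_nonneg)
        finally have "dist (t, u t + (r * s) *\<^sub>R h) (t, u t) < d"
          by (simp add: dist_Pair_Pair dist_norm)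
        then have "dist (G t (u t + (r * s) *\<^sub>R h)) (G t (u t)) < e'"
          using d(2)[of "(t, u t)" "(t, u t + (r * s) *\<^sub>R h)"] t nB in_B by (auto simp: K_def)
        then show "norm (G t (u t + r *\<^sub>R s *\<^sub>R h) - G t (u t)) \<le> e'"
          by (simp add: dist_norm)
      qed
      moreover have "e' * norm (s *\<^sub>R h) \<le> s * (e / T)"
      proof -
        have "e' * norm (s *\<^sub>R h) = s * (e' * norm h)" using s(1) by simp
        also have "\<dots> \<le> s * (e' * (2 * B + 1))"
          using s(1) e' nh by (intro mult_left_mono) auto
        also have "e' * (2 * B + 1) = e / T" using B(1) T by (simp add: e'_def)
        finally show ?thesis .
      qed
      ultimately show ?thesis using yw[OF t] by (simp add: h_def)
    qed
    have "measure lborel {0..T} *\<^sub>R (s * (e / T)) = s * e" using T by simp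
    then have const: "((\<lambda>t. s * (e / T)) has_integral s * e) {0..T}"
      using has_integral_const_real[of "s * (e / T)" 0 T] by (simp only:)
    have "((\<lambda>t. F t (u t) + s * (G t (u t) \<bullet> (U u t - u t)) - s * (e / T)) has_integral
        integral {0..T} (\<lambda>t. F t (u t)) + s * integral {0..T} (\<lambda>t. G t (u t) \<bullet> (U u t - u t)) - s * e) {0..T}"
      by (intro has_integral_diff has_integral_add has_integral_mult_right integrable_integral int const)
    then have "integral {0..T} (\<lambda>t. F t (u t)) + s * integral {0..T} (\<lambda>t. G t (u t) \<bullet> (U u t - u t)) - s * e
        = integral {0..T} (\<lambda>t. F t (u t) + s * (G t (u t) \<bullet> (U u t - u t)) - s * (e / T))"
      by (rule integral_unique[symmetric])
    also have "\<dots> \<le> integral {0..T} (\<lambda>t. F t (curve y w t))"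
      by (intro integral_le integrable_continuous_real continuous_intros c pw)
    finally have 3: "integral {0..T} (\<lambda>t. F t (u t)) + s * integral {0..T} (\<lambda>t. G t (u t) \<bullet> (U u t - u t)) - s * e
        \<le> integral {0..T} (\<lambda>t. F t (curve y w t))" .
    have "energy y w \<le> energy x v - s * (gap x v - e)"
      using 1 2 3 unfolding energy_def gap_def Let_def u_def[symmetric] by (simp add: algebra_simps)
    then show "energy (x + s *\<^sub>R (X (curve x v) - x)) (\<lambda>t. v t + s *\<^sub>R (V (curve x v) t - v t))
        \<le> energy x v - s * (gap x v - e)"
      by (simp add: y_def w_def[abs_def] u_def)
  qed
qed


section \<open>Descent\<close>

text \<open>The full step within radius r - 1 secures a fixed decrease, the zero step from r on
  fixes the constants of norm r, and the transition is continuous for the sake of Brouwer's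
  theorem.\<close>

definition cutoff :: "real \<Rightarrow> 'a \<Rightarrow> real" where
  "cutoff r x = max 0 (min 1 (r - norm x))"

definition step :: "real \<Rightarrow> real \<Rightarrow> 'a \<times> (real \<Rightarrow> 'a) \<Rightarrow> 'a \<times> (real \<Rightarrow> 'a)" where
  "step r \<theta> = (\<lambda>(x, v). let u = curve x v; s = \<theta> * cutoff r x
     in (x + s *\<^sub>R (X u - x), \<lambda>t. v t + s *\<^sub>R (V u t - v t)))"

lemma step_beyond_cutoff: "r \<le> norm x \<Longrightarrow> step r \<theta> (x, v) = (x, v)"
  by (simp add: step_def cutoff_def)

text \<open>Allowing half of the lower bound m of the gap as linearisation error leaves a decrease
  of \<open>s * (m / 2)\<close>, and s = \<theta> within radius r - 1.\<close>

lemma energy_descent: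
  assumes nofix: "\<nexists>u. continuous_on {0..T} u \<and> (\<forall>t\<in>{0..T}. u t = U u t)"
  obtains \<theta> c where "0 < c" "\<And>x v x' v'. admissible x v \<Longrightarrow> step r \<theta> (x, v) = (x', v') \<Longrightarrow>
    admissible x' v' \<and> energy x' v' \<le> energy x v \<and> (norm x \<le> r - 1 \<longrightarrow> energy x' v' \<le> energy x v - c)"
proof -
  obtain m where m: "0 < m" "\<And>x v. admissible x v \<Longrightarrow> norm x \<le> r \<Longrightarrow> m \<le> gap x v"
    using gap_bounded_below[OF nofix, of r] by blast
  obtain \<theta> where \<theta>: "0 < \<theta>" "\<theta> \<le> 1" "\<And>x v s. \<lbrakk>admissible x v; norm x \<le> r; 0 \<le> s; s \<le> \<theta>\<rbrakk> \<Longrightarrow>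
      energy (x + s *\<^sub>R (X (curve x v) - x)) (\<lambda>t. v t + s *\<^sub>R (V (curve x v) t - v t))
        \<le> energy x v - s * (gap x v - m / 2)"
    using energy_step_le[of "m / 2" r] m(1) half_gt_zero by blast
  show ?thesis
  proof (rule that[of "\<theta> * (m / 2)" \<theta>])
    show "0 < \<theta> * (m / 2)" using m(1) \<theta>(1) by simp
    fix x v x' v' assume adm: "admissible x v" and step: "step r \<theta> (x, v) = (x', v')"
    define s where "s = \<theta> * cutoff r x"
    have cut: "0 \<le> cutoff r x" "cutoff r x \<le> 1" by (auto simp: cutoff_def)
    have "0 \<le> s" "s \<le> \<theta>"
      using cut \<theta>(1) mult_left_mono[of "cutoff r x" 1 \<theta>] by (auto simp: s_def)
    with \<theta>(2) have s: "0 \<le> s" "s \<le> \<theta>" "s \<le> 1" by linarith+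
    have x': "x' = x + s *\<^sub>R (X (curve x v) - x)" and v': "v' = (\<lambda>t. v t + s *\<^sub>R (V (curve x v) t - v t))"
      using step unfolding step_def s_def Let_def by simp_all
    have cu: "continuous_on {0..T} (curve x v)"
      using adm continuous_curve by (auto simp: admissible_def)
    have 1: "admissible x' v'"
      unfolding x' v' by (rule admissible_step[OF adm admissible_XV[OF cu] s(1,3)])
    have 2: "energy x' v' \<le> energy x v - s * (m / 2)"
    proof (cases "norm x \<le> r")
      case True
      have "energy x' v' \<le> energy x v - s * (gap x v - m / 2)"
        unfolding x' v' by (rule \<theta>(3)[OF adm True s(1,2)])
      moreover have "s * (m / 2) \<le> s * (gap x v - m / 2)"
        using m(2)[OF adm True] s(1) by (intro mult_left_mono) auto
      ultimately show ?thesis by linarith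
    next
      case False
      then have "s = 0" by (simp add: s_def cutoff_def)
      then show ?thesis by (simp add: x' v')
    qed
    moreover have "0 \<le> s * (m / 2)" using s(1) m(1) by simp
    moreover have "s = \<theta>" if "norm x \<le> r - 1" using that by (simp add: s_def cutoff_def)
    ultimately show "admissible x' v' \<and> energy x' v' \<le> energy x v \<and>
        (norm x \<le> r - 1 \<longrightarrow> energy x' v' \<le> energy x v - \<theta> * (m / 2))"
      using 1 by (intro conjI impI) (blast | linarith | simp)+
  qed
qed

text \<open>Energies between L and E force the initial value into the ball where a step gains c. As
  the energy never increases, an iterate still at level L or above has gained c in every earlier
  step. The resulting k is the same for all starting curves, so that a single iterate can be studied
  on a whole ball of constants.\<close>

lemma descent_below_level:
  assumes nofix: "\<nexists>u. continuous_on {0..T} u \<and> (\<forall>t\<in>{0..T}. u t = U u t)"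
    and strip: "\<And>y w. admissible y w \<Longrightarrow> L \<le> energy y w \<Longrightarrow> energy y w \<le> E \<Longrightarrow> norm y \<le> r - 1"
  obtains \<theta> k where "\<And>x v y w. admissible x v \<Longrightarrow> energy x v \<le> E \<Longrightarrow> (step r \<theta> ^^ k) (x, v) = (y, w) \<Longrightarrow>
    admissible y w \<and> energy y w < L"
proof (rule energy_descent[OF nofix, of r])
  fix \<theta> c
  assume c: "0 < c" "\<And>x v x' v'. admissible x v \<Longrightarrow> step r \<theta> (x, v) = (x', v') \<Longrightarrow>
    admissible x' v' \<and> energy x' v' \<le> energy x v \<and> (norm x \<le> r - 1 \<longrightarrow> energy x' v' \<le> energy x v - c)"
  have iter: "admissible y w \<and> energy y w \<le> E \<and> (L \<le> energy y w \<longrightarrow> energy y w \<le> E - real k * c)"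
    if "admissible x v" "energy x v \<le> E" "(step r \<theta> ^^ k) (x, v) = (y, w)" for k x v y w
    using that(3)
  proof (induction k arbitrary: y w)
    case 0
    then show ?case using that by simp
  next
    case (Suc k)
    obtain y' w' where yw': "(step r \<theta> ^^ k) (x, v) = (y', w')" by fastforce
    note IH = Suc.IH[OF yw']
    have "step r \<theta> (y', w') = (y, w)" using Suc.prems yw' by simp
    note desc = c(2)[OF conjunct1[OF IH] this]
    have "energy y w \<le> E - real (Suc k) * c" if L: "L \<le> energy y w"
    proof -
      have L': "L \<le> energy y' w'" using L desc by linarith
      then have "norm y' \<le> r - 1" using IH strip by blast
      then have "energy y w \<le> energy y' w' - c" using desc by blast
      moreover have "energy y' w' \<le> E - real k * c" using IH L' by blast
      ultimately show ?thesis by (simp add: algebra_simps)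
    qed
    moreover have "energy y w \<le> E" using desc IH by linarith
    ultimately show ?case using desc by blast
  qed
  obtain k :: nat where "(E - L) / c < k" using reals_Archimedean2 by blast
  then have k: "E - real k * c < L" using c(1) by (simp add: field_simps)
  show ?thesis
  proof (rule that)
    fix x v y w
    assume "admissible x v" "energy x v \<le> E" "(step r \<theta> ^^ k) (x, v) = (y, w)"
    note it = iter[OF this]
    have "energy y w < L"
    proof (rule ccontr)
      assume "\<not> energy y w < L"
      with it have "energy y w \<le> E - real k * c" by simp
      with k \<open>\<not> energy y w < L\<close> show False by linarith
    qed
    with it show "admissible y w \<and> energy y w < L" by blast
  qed
qed

section \<open>Continuity of the iterates in the starting point\<close>

lemma step_tendsto:
  assumes x: "x \<longlonglongrightarrow> x0" and v: "uniform_limit {0..T} v v0 sequentially"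
    and cv: "\<And>n. continuous_on {0..T} (v n)" "continuous_on {0..T} v0"
  shows "(\<lambda>n. fst (step r \<theta> (x n, v n))) \<longlonglongrightarrow> fst (step r \<theta> (x0, v0))"
    and "uniform_limit {0..T} (\<lambda>n. snd (step r \<theta> (x n, v n))) (snd (step r \<theta> (x0, v0))) sequentially"
    and "continuous_on {0..T} (snd (step r \<theta> (x0, v0)))"
proof -
  have cu: "continuous_on {0..T} (curve (x n) (v n))" "continuous_on {0..T} (curve x0 v0)" for n
    by (intro continuous_curve cv)+
  have u: "uniform_limit {0..T} (\<lambda>n. curve (x n) (v n)) (curve x0 v0) sequentially"
    unfolding curve_def[abs_def]
    by (intro uniform_limit_add uniform_limit_tendsto_const x uniform_limit_indefinite_integral v cv)
  have s: "(\<lambda>n. \<theta> * cutoff r (x n)) \<longlonglongrightarrow> \<theta> * cutoff r x0"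
    unfolding cutoff_def by (intro tendsto_intros x)
  show "(\<lambda>n. fst (step r \<theta> (x n, v n))) \<longlonglongrightarrow> fst (step r \<theta> (x0, v0))"
    unfolding step_def Let_def prod.case fst_conv
    by (intro tendsto_intros s x X_tendsto cu u)
  have bdd: "bounded ((\<lambda>t. V (curve x0 v0) t - v0 t) ` {0..T})"
    by (intro compact_imp_bounded compact_continuous_image continuous_intros continuous_V cu cv) simp
  show "uniform_limit {0..T} (\<lambda>n. snd (step r \<theta> (x n, v n))) (snd (step r \<theta> (x0, v0))) sequentially"
    unfolding step_def Let_def prod.case snd_conv
    by (intro uniform_limit_add v bounded_bilinear.bounded_uniform_limit[OF bounded_bilinear_scaleR]
        uniform_limit_tendsto_const s uniform_limit_minus V_uniform_limit cu u bdd)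
      (simp add: image_constant_conv)
  show "continuous_on {0..T} (snd (step r \<theta> (x0, v0)))"
    unfolding step_def Let_def prod.case snd_conv
    by (intro continuous_intros cv continuous_V cu)
qed

text \<open>Continuity of the velocities is carried through the induction because
  \<open>step_tendsto\<close> presupposes it.\<close>

lemma iterated_step_tendsto:
  assumes "x \<longlonglongrightarrow> x0"
  shows "(\<lambda>n. fst ((step r \<theta> ^^ k) (x n, \<lambda>t. 0))) \<longlonglongrightarrow> fst ((step r \<theta> ^^ k) (x0, \<lambda>t. 0)) \<and>
    uniform_limit {0..T} (\<lambda>n. snd ((step r \<theta> ^^ k) (x n, \<lambda>t. 0))) (snd ((step r \<theta> ^^ k) (x0, \<lambda>t. 0))) sequentially
    \<and> (\<forall>x. continuous_on {0..T} (snd ((step r \<theta> ^^ k) (x, \<lambda>t. 0))))"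
proof (induction k)
  case 0
  then show ?case using assms by (simp add: uniform_limit_iff)
next
  case (Suc k)
  have c: "continuous_on {0..T} (snd ((step r \<theta> ^^ k) (x, \<lambda>t. 0)))" for x using Suc by blast
  have "continuous_on {0..T} (snd (step r \<theta> (fst p, snd p)))" if "continuous_on {0..T} (snd p)" for p
    using that by (intro step_tendsto(3)[of "\<lambda>n. fst p" "fst p" "\<lambda>n. snd p"]) (auto simp: uniform_limit_iff)
  with c have "\<forall>x. continuous_on {0..T} (snd ((step r \<theta> ^^ Suc k) (x, \<lambda>t. 0)))" by simp
  then show ?case
    using step_tendsto(1,2)[OF conjunct1[OF Suc] conjunct1[OF conjunct2[OF Suc]] c c] by simp
qed

text \<open>The linking property: the iterates fix the constants of norm at least \<open>r\<close>.\<close>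

lemma iterated_step_zero:
  assumes "0 \<le> r"
  shows "\<exists>x\<in>cball 0 r. fst ((step r \<theta> ^^ k) (x, \<lambda>t. 0)) = 0"
proof (cases "r = 0")
  \<comment> \<open>On the sphere the iterate is the identity, so the product tested in
    \<open>coercive_zero\<close> is r^2, which is positive only for r > 0. For r = 0 the origin
    itself is fixed.\<close>
  case True
  have "(step r \<theta> ^^ k) (0, \<lambda>t. 0) = (0, \<lambda>t. 0)"
    using True by (induction k) (auto simp: step_beyond_cutoff)
  then show ?thesis using assms by (intro bexI[of _ 0]) auto
next
  case False
  show ?thesis
  proof (rule coercive_zero[OF _ assms])
    show "continuous_on (cball 0 r) (\<lambda>x. fst ((step r \<theta> ^^ k) (x, \<lambda>t. 0)))"
      using iterated_step_tendsto by (auto simp: continuous_on_sequentially o_def)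
    fix x :: 'a assume x: "norm x = r"
    have "(step r \<theta> ^^ k) (x, \<lambda>t. 0) = (x, \<lambda>t. 0)"
      using x by (induction k) (auto simp: step_beyond_cutoff)
    then show "0 < fst ((step r \<theta> ^^ k) (x, \<lambda>t. 0)) \<bullet> x" using x False by auto
  qed
qed

section \<open>Energy levels in the two alternatives\<close>

lemma F_bounded:
  obtains K where "0 \<le> K" "\<And>t x. t \<in> {0..T} \<Longrightarrow> norm x \<le> R \<Longrightarrow> \<bar>F t x\<bar> \<le> K"
proof -
  have "compact ({0..T} \<times> cball (0::'a) R)" by (intro compact_Times compact_Icc compact_cball)
  moreover have "continuous_on ({0..T} \<times> cball 0 R) (\<lambda>(t, x). F t x)"
    by (rule continuous_on_subset[OF F_cont]) auto
  ultimately have "bounded ((\<lambda>(t, x). F t x) ` ({0..T} \<times> cball 0 R))"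
    by (intro compact_imp_bounded compact_continuous_image)
  then obtain K where "0 < K" "\<And>t x. t \<in> {0..T} \<Longrightarrow> norm x \<le> R \<Longrightarrow> \<bar>F t x\<bar> \<le> K"
    by (force simp: bounded_pos)
  then show ?thesis by (intro that[of K]) auto
qed

lemma energy_ge:
  assumes adm: "admissible x v" and F: "\<And>t. t \<in> {0..T} \<Longrightarrow> F t (curve x v t) \<le> K"
  shows "T * \<Phi> 0 - T * K \<le> energy x v"
proof -
  have v: "continuous_on {0..T} v" "\<And>t. t \<in> {0..T} \<Longrightarrow> norm (v t) \<le> a" and D: "(x, curve x v T) \<in> D"
    using adm by (auto simp: admissible_def)
  have "integral {0..T} (\<lambda>t. \<Phi> 0) \<le> integral {0..T} (\<lambda>t. \<Phi> (v t))"
    by (intro integral_le integrable_continuous_real continuous_intros continuous_Phi v Phi_min) (auto simp: v)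
  moreover have "integral {0..T} (\<lambda>t. F t (curve x v t)) \<le> integral {0..T} (\<lambda>t. K)"
    by (intro integral_le integrable_continuous_real continuous_intros continuous_F continuous_curve v F)
  ultimately show ?thesis
    using J_nonneg[OF D] T by (simp add: energy_def)
qed

lemma energy_le:
  assumes adm: "admissible x v" and F: "\<And>t. t \<in> {0..T} \<Longrightarrow> K \<le> F t (curve x v t)"
  shows "energy x v \<le> J (x, curve x v T) - T * K"
proof -
  have v: "continuous_on {0..T} v" "\<And>t. t \<in> {0..T} \<Longrightarrow> norm (v t) \<le> a"
    using adm by (auto simp: admissible_def)
  have "integral {0..T} (\<lambda>t. \<Phi> (v t)) \<le> integral {0..T} (\<lambda>t. 0)"
    by (intro integral_le integrable_continuous_real continuous_intros continuous_Phi v Phi_nonpos) (auto simp: v)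
  moreover have "integral {0..T} (\<lambda>t. K) \<le> integral {0..T} (\<lambda>t. F t (curve x v t))"
    by (intro integral_le integrable_continuous_real continuous_intros continuous_F continuous_curve v F)
  ultimately show ?thesis
    using T by (simp add: energy_def)
qed

lemma curve_norm_ge:
  assumes "admissible x v" "t \<in> {0..T}"
  shows "norm x - a * T \<le> norm (curve x v t)"
  using curve_norm_le[of v t x] norm_triangle_sub[of x "curve x v t"] assms
  by (auto simp: admissible_def norm_minus_commute)

lemma admissible_const: "(x, x) \<in> D \<Longrightarrow> admissible x (\<lambda>t. 0)"
  using a by (simp add: admissible_def curve_def)

text \<open>A curve starting beyond \<rho> + a T stays beyond \<rho> and has energy at least T
  (\<Phi> 0 + \<epsilon>), more than the level T \<Phi> 0 at which the descent from the zero curve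
  begins. Hence the descent stays where its steps are full.\<close>

theorem fixed_point_if_negative_at_infinity:
  assumes F_0: "\<And>t. t \<in> {0..T} \<Longrightarrow> F t 0 = 0"
    and "0 < \<epsilon>" and F_inf: "\<And>t x. t \<in> {0..T} \<Longrightarrow> \<rho> < norm x \<Longrightarrow> F t x \<le> - \<epsilon>"
  shows "\<exists>u. continuous_on {0..T} u \<and> (\<forall>t\<in>{0..T}. u t = U u t)"
proof (rule ccontr)
  assume nofix: "\<not> ?thesis"
  obtain K where K: "0 \<le> K" "\<And>t x. t \<in> {0..T} \<Longrightarrow> norm x \<le> \<rho> \<Longrightarrow> \<bar>F t x\<bar> \<le> K"
    using F_bounded[of \<rho>] by metis
  have FK: "F t x \<le> K" if "t \<in> {0..T}" for t x
    using K(2)[OF that, of x] F_inf[OF that, of x] \<open>0 < \<epsilon>\<close> K(1) by (cases "norm x \<le> \<rho>") auto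
  have adm0: "admissible 0 (\<lambda>t. 0)" by (rule admissible_const) (rule J_0)
  have e0: "energy 0 (\<lambda>t. 0) \<le> T * \<Phi> 0"
  proof -
    have "integral {0..T} (\<lambda>t. F t (curve 0 (\<lambda>t. 0) t)) = integral {0..T} (\<lambda>t. 0)"
      by (intro integral_cong) (simp add: curve_def F_0)
    then show ?thesis using T J_0(2) by (simp add: energy_def curve_def)
  qed
  have strip: "norm y \<le> (\<rho> + a * T + 1) - 1" if adm: "admissible y w" and "T * \<Phi> 0 - T * K \<le> energy y w" "energy y w \<le> T * \<Phi> 0" for y w
  proof (rule ccontr)
    assume "\<not> ?thesis"
    then have "F t (curve y w t) \<le> - \<epsilon>" if "t \<in> {0..T}" for t
      using curve_norm_ge[OF adm that] by (intro F_inf that) simp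
    then have "T * \<Phi> 0 - T * (- \<epsilon>) \<le> energy y w" by (rule energy_ge[OF adm])
    moreover have "0 < T * \<epsilon>" using T \<open>0 < \<epsilon>\<close> by simp
    ultimately show False using that(3) by simp
  qed
  obtain \<theta> k where below: "\<And>x v y w. admissible x v \<Longrightarrow> energy x v \<le> T * \<Phi> 0 \<Longrightarrow>
      (step (\<rho> + a * T + 1) \<theta> ^^ k) (x, v) = (y, w) \<Longrightarrow> admissible y w \<and> energy y w < T * \<Phi> 0 - T * K"
    by (rule descent_below_level[OF nofix], erule (2) strip) blast
  obtain y w where "(step (\<rho> + a * T + 1) \<theta> ^^ k) (0, \<lambda>t. 0) = (y, w)" by fastforce
  then have "admissible y w" "energy y w < T * \<Phi> 0 - T * K"
    using below[OF adm0 e0] by auto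
  moreover have "T * \<Phi> 0 - T * K \<le> energy y w"
    by (rule energy_ge) (use \<open>admissible y w\<close> FK in auto)
  ultimately show False by simp
qed

text \<open>Curves from the origin stay within radius a T, which gives the lower bound L of their
  energies. Far out F is so large that the energy is below L already, so levels above L are met only
  where the steps are full.\<close>

theorem fixed_point_if_tending_to_infinity:
  assumes diag: "\<And>x. (x, x) \<in> D" "\<And>x. J (x, x) = 0" and J_le: "\<And>z. z \<in> D \<Longrightarrow> J z \<le> M"
    and F_inf: "\<And>K. \<exists>\<rho>>0. \<forall>t\<in>{0..T}. \<forall>x. \<rho> < norm x \<longrightarrow> K < F t x"
  shows "\<exists>u. continuous_on {0..T} u \<and> (\<forall>t\<in>{0..T}. u t = U u t)"
proof (rule ccontr)
  assume nofix: "\<not> ?thesis"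
  obtain K where K: "\<And>t x. t \<in> {0..T} \<Longrightarrow> norm x \<le> a * T \<Longrightarrow> \<bar>F t x\<bar> \<le> K"
    using F_bounded[of "a * T"] by metis
  define L where "L = T * \<Phi> 0 - T * K"
  have link: "L \<le> energy 0 w" if adm: "admissible 0 w" for w
    unfolding L_def
  proof (rule energy_ge[OF adm])
    fix t assume t: "t \<in> {0..T}"
    have "norm (curve 0 w t) \<le> a * T"
      using curve_norm_le[of w t 0] adm t by (auto simp: admissible_def)
    from K[OF t this] show "F t (curve 0 w t) \<le> K" by simp
  qed
  \<comment> \<open>With this threshold the energy far out is at most M - (M - L + 1) = L -
    1.\<close>
  obtain \<rho> where \<rho>: "0 < \<rho>" "\<forall>t\<in>{0..T}. \<forall>x. \<rho> < norm x \<longrightarrow> (M - L + 1) / T < F t x"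
    using F_inf[of "(M - L + 1) / T"] by blast
  define r where "r = \<rho> + a * T + 1"
  have r0: "0 \<le> r" using \<rho>(1) a T by (simp add: r_def)
  obtain K' where K': "\<And>t x. t \<in> {0..T} \<Longrightarrow> norm x \<le> r \<Longrightarrow> \<bar>F t x\<bar> \<le> K'"
    using F_bounded[of r] by metis
  have start: "energy x (\<lambda>t. 0) \<le> T * K'" if "norm x \<le> r" for x
  proof -
    have "energy x (\<lambda>t. 0) \<le> J (x, curve x (\<lambda>t. 0) T) - T * (- K')"
    proof (rule energy_le[OF admissible_const[OF diag(1)]])
      fix t assume "t \<in> {0..T}"
      from K'[OF this that] show "- K' \<le> F t (curve x (\<lambda>t. 0) t)" by (simp add: curve_def)
    qed
    then show ?thesis by (simp add: curve_def diag(2))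
  qed
  have strip: "norm y \<le> r - 1" if adm: "admissible y w" and "L \<le> energy y w" "energy y w \<le> T * K'" for y w
  proof (rule ccontr)
    assume far: "\<not> ?thesis"
    have "(M - L + 1) / T \<le> F t (curve y w t)" if "t \<in> {0..T}" for t
    proof -
      have "\<rho> < norm (curve y w t)" using curve_norm_ge[OF adm that] far by (simp add: r_def)
      then show ?thesis using \<rho>(2) that less_imp_le by blast
    qed
    then have "energy y w \<le> J (y, curve y w T) - T * ((M - L + 1) / T)" by (rule energy_le[OF adm])
    moreover have "J (y, curve y w T) \<le> M" using adm by (intro J_le) (simp add: admissible_def)
    moreover have "T * ((M - L + 1) / T) = M - L + 1" using T by simp
    ultimately show False using that(2) by linarith
  qed
  obtain \<theta> k where below: "\<And>x v y w. admissible x v \<Longrightarrow> energy x v \<le> T * K' \<Longrightarrow>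
      (step r \<theta> ^^ k) (x, v) = (y, w) \<Longrightarrow> admissible y w \<and> energy y w < L"
    by (rule descent_below_level[OF nofix], erule (2) strip) blast
  obtain x where x: "norm x \<le> r" "fst ((step r \<theta> ^^ k) (x, \<lambda>t. 0)) = 0"
    using iterated_step_zero[OF r0, where \<theta> = \<theta> and k = k] by auto
  then obtain w where "(step r \<theta> ^^ k) (x, \<lambda>t. 0) = (0, w)" by (metis prod.collapse)
  from below[OF admissible_const[OF diag(1)] start[OF x(1)] this] link[of w] show False by simp
qed

end

section \<open>From fixed points to solutions\<close>

lemma (in relativistic_bvp) fixed_point_is_solution:
  assumes u: "continuous_on {0..T} u" and fp: "\<And>t. t \<in> {0..T} \<Longrightarrow> u t = U u t"
    and phi: "\<And>w. \<phi> (\<psi> w) = w"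
    and sub: "\<And>q. q - prox q \<in> subdifferential j (prox q)"
  shows "is_solution T a \<phi> G j u"
proof -
  have phiV: "\<phi> (V u t) = P u + W u t" for t
    by (simp add: V_def phi)
  have ends: "bdry u (P u) = (u 0, u T)"
    using bdry_P[OF u] fp T by simp
  then have "(P u + u 0, u T - W u T - P u) - (u 0, u T) \<in> subdifferential j (u 0, u T)"
    using sub[of "(P u + u 0, u T - W u T - P u)"] by (simp only: bdry_def)
  \<comment> \<open>The end points that the penalty adds to the argument of \<open>prox\<close>
    cancel here, and \<open>W u\<close> vanishes at 0. What remains is the momentum at 0 and minus
    the momentum at T.\<close>
  moreover have "(P u + u 0, u T - W u T - P u) - (u 0, u T) = (\<phi> (V u 0), - \<phi> (V u T))"
    by (simp add: phiV W_def)
  ultimately have bc: "(\<phi> (V u 0), - \<phi> (V u T)) \<in> subdifferential j (u 0, u T)" by (simp only:)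
  have "(u has_vector_derivative V u t) (at t within {0..T})" if t: "t \<in> {0..T}" for t
  proof (rule has_vector_derivative_transform[OF t fp])
    show "(U u has_vector_derivative V u t) (at t within {0..T})"
      unfolding U_eq_curve by (rule curve_has_vector_derivative[OF continuous_V[OF u] t])
  qed
  then have "C1_with_deriv_on {0..T} u (V u)"
    by (simp add: C1_with_deriv_on_def continuous_V[OF u])
  moreover have "C1_with_deriv_on {0..T} (\<lambda>t. \<phi> (V u t)) (\<lambda>t. - G t (u t))"
    using has_vector_derivative_add[OF has_vector_derivative_const W_has_vector_derivative[OF u]]
    by (simp add: C1_with_deriv_on_def phiV continuous_on_minus continuous_G[OF u])
  moreover have "norm (V u t) < a" for t
    unfolding V_def by (rule psi_less)
  ultimately show ?thesis
    using bc unfolding is_solution_def subdiff_dom_def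
    by (intro exI[of _ "V u"] exI[of _ "\<lambda>t. - G t (u t)"]) auto
qed

theorem theorem4p15:
  fixes T a :: real
    and \<phi> :: "real ^ 'n \<Rightarrow> real ^ 'n"
    and \<Phi> :: "real ^ 'n \<Rightarrow> real"
    and F :: "real \<Rightarrow> real ^ 'n \<Rightarrow> real"
    and G :: "real \<Rightarrow> real ^ 'n \<Rightarrow> real ^ 'n"
    and j :: "(real ^ 'n) \<times> (real ^ 'n) \<Rightarrow> ereal"
  assumes "0 < T" and "0 < a"
    and phi_homeo: "\<exists>\<psi>. homeomorphism (ball 0 a) UNIV \<phi> \<psi>"
    and phi_0: "\<phi> 0 = 0"
    and Phi_grad: "\<forall>x\<in>ball 0 a. GDERIV \<Phi> x :> \<phi> x"
    and Phi_nonpos: "\<forall>x\<in>cball 0 a. \<Phi> x \<le> 0"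
    and Phi_cont: "continuous_on (cball 0 a) \<Phi>"
    and Phi_convex: "strictly_convex_on (cball 0 a) \<Phi>"
    and F_cont: "continuous_on ({0..T} \<times> UNIV) (\<lambda>(t, x). F t x)"
    and F_grad: "\<forall>t\<in>{0..T}. \<forall>x. GDERIV (F t) x :> G t x"
    and G_cont: "continuous_on ({0..T} \<times> UNIV) (\<lambda>(t, x). G t x)"
    and F_0: "\<forall>t\<in>{0..T}. F t 0 = 0"
    and j_proper: "proper_fun j"
    and j_convex: "econvex j"
    and j_lsc: "lower_semicont j"
    and j_0: "j (0, 0) = 0"
    and j_subdiff_0: "(0, 0) \<in> subdifferential j (0, 0)"
    and alternatives:
      "(\<exists>\<epsilon>>0. \<exists>\<rho>>0. \<forall>t\<in>{0..T}. \<forall>x. norm x > \<rho> \<longrightarrow>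
           F t x < (INF y\<in>cball 0 a. \<Phi> y) - \<Phi> 0 - \<epsilon>)
       \<or> ((\<forall>x. j (x, x) = 0)
          \<and> (\<exists>M::real. \<forall>z\<in>eff_dom j. \<bar>j z\<bar> \<le> ereal M)
          \<and> (\<forall>M::real. \<exists>\<rho>>0. \<forall>t\<in>{0..T}. \<forall>x. norm x > \<rho> \<longrightarrow> F t x > M))"
  shows "\<exists>u. is_solution T a \<phi> G j u"
proof -
  obtain \<psi> where hom: "homeomorphism (ball 0 a) UNIV \<phi> \<psi>" using phi_homeo by blast
  have psi_ball: "\<psi> w \<in> ball 0 a" and phi_psi: "\<phi> (\<psi> w) = w" for w
    using hom by (auto simp: homeomorphism_def)
  \<comment> \<open>As j vanishes at the origin, the subgradient 0 there makes the origin a global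
    minimum of j.\<close>
  have nonneg: "0 \<le> j z" for z
    using j_subdiff_0 j_0 by (cases z) (simp add: subdifferential_def zero_prod_def[symmetric])
  have j00: "j (0, 0) < \<infinity>" by (simp add: j_0)
  define D where "D = eff_dom j"
  define J where "J z = real_of_ereal (j z)" for z
  have jJ: "j z = ereal (J z)" if "z \<in> D" for z
    using that nonneg[of z] by (auto simp: D_def eff_dom_def J_def ereal_real)
  define prox where "prox q = (SOME z. q - z \<in> subdifferential j z)" for q
  have prox: "q - prox q \<in> subdifferential j (prox q)" for q
    unfolding prox_def by (rule someI_ex) (rule proximal_point_exists[OF j_lsc j_convex nonneg j00])
  have prox_D: "prox q \<in> D" for q
  proof -
    have "j (prox q) + ereal ((q - prox q) \<bullet> ((0, 0) - prox q)) \<le> j (0, 0)"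
      using prox[of q] by (auto simp: subdifferential_def)
    then show ?thesis using j_0 by (cases "j (prox q)") (auto simp: D_def eff_dom_def)
  qed
  have j_conv: "(1 - s) *\<^sub>R z + s *\<^sub>R z' \<in> D \<and> J ((1 - s) *\<^sub>R z + s *\<^sub>R z') \<le> (1 - s) * J z + s * J z'"
    if z: "z \<in> D" "z' \<in> D" and s: "0 \<le> s" "s \<le> 1" for z z' s
  proof (cases "s = 0 \<or> s = 1")
    case False
    then have "0 < s \<and> s < 1" using s by auto
    then have "j ((1 - s) *\<^sub>R z + s *\<^sub>R z') \<le> ereal (1 - s) * j z + ereal s * j z'"
      using j_convex unfolding econvex_def by blast
    then have *: "j ((1 - s) *\<^sub>R z + s *\<^sub>R z') \<le> ereal ((1 - s) * J z + s * J z')"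
      by (simp add: jJ z)
    then have "(1 - s) *\<^sub>R z + s *\<^sub>R z' \<in> D" by (auto simp: D_def eff_dom_def)
    then show ?thesis using * jJ by simp
  qed (use z in auto)
  interpret relativistic_bvp T a \<psi> \<Phi> F G D J prox
  proof
    show "0 < T" "0 < a" by fact+
    show "continuous_on UNIV \<psi>" using hom by (simp add: homeomorphism_def)
    show "inj \<psi>" using phi_psi by (metis injI)
    show "norm (\<psi> w) < a" for w using psi_ball[of w] by simp
    show "continuous_on (cball 0 a) \<Phi>" by fact
    show "\<Phi> v \<le> 0" if "v \<in> cball 0 a" for v using Phi_nonpos that by blast
    \<comment> \<open>A critical point of the convex \<Phi> is its minimum.\<close>
    have "GDERIV \<Phi> 0 :> 0" using Phi_grad \<open>0 < a\<close> phi_0 by (metis centre_in_ball)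
    then show "\<Phi> 0 \<le> \<Phi> v" if "v \<in> cball 0 a" for v
      using strictly_convex_on_gradient[OF Phi_convex, of 0 0 v] \<open>0 < a\<close> that
      by (cases "v = 0") auto
    show "\<Phi> ((1 - s) *\<^sub>R v + s *\<^sub>R v') \<le> (1 - s) * \<Phi> v + s * \<Phi> v'"
      if v: "v \<in> cball 0 a" "v' \<in> cball 0 a" and s: "0 \<le> s" "s \<le> 1" for v v' s
    proof (cases "s = 0 \<or> s = 1 \<or> v = v'")
      case True
      then show ?thesis by (auto simp flip: scaleR_left_distrib distrib_right)
    next
      case False
      with s have "v \<noteq> v'" "0 < s" "s < 1" by auto
      with Phi_convex v show ?thesis unfolding strictly_convex_on_def by (blast intro: less_imp_le)
    qed
    show "\<Phi> (\<psi> w) + w \<bullet> (v - \<psi> w) < \<Phi> v" if "v \<in> cball 0 a" "v \<noteq> \<psi> w" for v w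
    proof -
      have "GDERIV \<Phi> (\<psi> w) :> w" using Phi_grad psi_ball[of w] phi_psi[of w] by metis
      moreover have "\<psi> w \<in> cball 0 a" using psi_ball[of w] by simp
      ultimately show ?thesis
        using that by (intro strictly_convex_on_gradient[OF Phi_convex]) auto
    qed
    show "continuous_on ({0..T} \<times> UNIV) (\<lambda>(t, x). F t x)" "continuous_on ({0..T} \<times> UNIV) (\<lambda>(t, x). G t x)"
      by fact+
    show "GDERIV (F t) x :> G t x" if "t \<in> {0..T}" for t x using F_grad that by blast
    show "(0, 0) \<in> D" using j00 by (simp add: D_def eff_dom_def)
    show "J (0, 0) = 0" by (simp add: J_def j_0)
    show "0 \<le> J z" for z using nonneg[of z] by (simp add: J_def real_of_ereal_pos)
    show "(1 - s) *\<^sub>R z + s *\<^sub>R z' \<in> D" if "z \<in> D" "z' \<in> D" "0 \<le> s" "s \<le> 1" for z z' s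
      using j_conv[OF that] by blast
    show "J ((1 - s) *\<^sub>R z + s *\<^sub>R z') \<le> (1 - s) * J z + s * J z'"
      if "z \<in> D" "z' \<in> D" "0 \<le> s" "s \<le> 1" for z z' s
      using j_conv[OF that] by blast
    show "prox q \<in> D" for q by (rule prox_D)
    show "J (prox q) + (q - prox q) \<bullet> (z - prox q) \<le> J z" if "z \<in> D" for z q
    proof -
      have "j (prox q) + ereal ((q - prox q) \<bullet> (z - prox q)) \<le> j z"
        using prox[of q] unfolding subdifferential_def by blast
      then show ?thesis by (simp add: jJ prox_D that)
    qed
  qed
  have "\<exists>u. continuous_on {0..T} u \<and> (\<forall>t\<in>{0..T}. u t = U u t)"
    using alternatives
  proof (elim disjE exE conjE)
    fix \<epsilon> \<rho> :: real
    assume "0 < \<epsilon>" and F: "\<forall>t\<in>{0..T}. \<forall>x. norm x > \<rho> \<longrightarrow> F t x < (INF y\<in>cball 0 a. \<Phi> y) - \<Phi> 0 - \<epsilon>"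
    \<comment> \<open>This brings the threshold of the first alternative down to at most
      -\<epsilon>.\<close>
    have "(INF y\<in>cball 0 a. \<Phi> y) \<le> \<Phi> 0"
      using \<open>0 < a\<close> Phi_min by (intro cINF_lower bdd_belowI2[of _ "\<Phi> 0"]) auto
    then have "F t x \<le> - \<epsilon>" if "t \<in> {0..T}" "\<rho> < norm x" for t x
      using F that by force
    then show ?thesis
      using F_0 \<open>0 < \<epsilon>\<close> by (intro fixed_point_if_negative_at_infinity[of \<epsilon> \<rho>]) auto
  next
    fix M
    assume diag: "\<forall>x. j (x, x) = 0" and bdd: "\<forall>z\<in>eff_dom j. \<bar>j z\<bar> \<le> ereal M"
      and F: "\<forall>M. \<exists>\<rho>>0. \<forall>t\<in>{0..T}. \<forall>x. norm x > \<rho> \<longrightarrow> F t x > M"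
    show ?thesis
    proof (rule fixed_point_if_tending_to_infinity[of M])
      show "(x, x) \<in> D" "J (x, x) = 0" for x using diag by (auto simp: D_def eff_dom_def J_def)
      show "J z \<le> M" if "z \<in> D" for z using bdd jJ[OF that] that by (force simp: D_def)
      show "\<exists>\<rho>>0. \<forall>t\<in>{0..T}. \<forall>x. \<rho> < norm x \<longrightarrow> K < F t x" for K using F by blast
    qed
  qed
  then obtain u where u: "continuous_on {0..T} u" "\<And>t. t \<in> {0..T} \<Longrightarrow> u t = U u t" by blast
  show ?thesis
    using fixed_point_is_solution[OF u phi_psi prox] by blast
qed

end
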